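(* Let $T>0$ and let $Y=(Y_t)_{t\in[0,T]}$ and $Z=(Z_t)_{t\in[0,T]}$ be two real-valued càdlàg finite quadratic variation processes on a probability space $(\Omega,\mathcal F,\mathbb P)$. Suppose that $[Y,Y]^c=0$. Then the covariation $[Y,Z]$ exists and $$[Y,Z]=\sum_{t\le\cdot}\Delta Y_t\,\Delta Z_t .$$
   Context: Covariation: for càdlàg processes $Y,Z$ on $[0,T]$, $[Y,Z]$ is the u.c.p. limit (limit in probability, uniformly on $[0,T]$) as $\varepsilon\to0+$, if it exists, of $t\mapsto\frac1\varepsilon\int_0^t(Y_{(s+\varepsilon)\wedge t}-Y_s)(Z_{(s+\varepsilon)\wedge t}-Z_s)\,ds$. $Y$ is a finite quadratic variation process if $[Y,Y]$ exists; then $[Y,Y]=[Y,Y]^c+\sum_{s\le\cdot}|\Delta Y_s|^2$, where $[Y,Y]^c$ is the continuous component of the increasing process $[Y,Y]$. Here $\Delta Y_t=Y_t-Y_{t-}$, and sums over $t\le\cdot$ run over jump times in $]0,\cdot]$. *)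

theory Defs
  imports "HOL-Probability.Probability"
begin

text \<open>
  A process indexed by \<open>[0,T]\<close> is a function \<open>Y :: real \<Rightarrow> 'a \<Rightarrow> real\<close>, of which only the values
  \<open>Y t \<omega>\<close> with \<open>t \<in> {0..T}\<close> matter.
\<close>

definition cadlag_on :: "real \<Rightarrow> (real \<Rightarrow> real) \<Rightarrow> bool" where
  "cadlag_on T f \<longleftrightarrow>
     (\<forall>t\<in>{0..<T}. (f \<longlongrightarrow> f t) (at_right t)) \<and>
     (\<forall>t\<in>{0<..T}. \<exists>l. (f \<longlongrightarrow> l) (at_left t))"

text \<open>As usual for processes considered up to indistinguishability, paths are cadlag almost surely.\<close>

definition cadlag_process :: "'a measure \<Rightarrow> real \<Rightarrow> (real \<Rightarrow> 'a \<Rightarrow> real) \<Rightarrow> bool" where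
  "cadlag_process M T Y \<longleftrightarrow>
     (\<forall>t\<in>{0..T}. Y t \<in> borel_measurable M) \<and>
     (AE \<omega> in M. cadlag_on T (\<lambda>t. Y t \<omega>))"

definition jump :: "(real \<Rightarrow> real) \<Rightarrow> real \<Rightarrow> real" where
  "jump f t = f t - Lim (at_left t) f"

text \<open>
  The continuous component of an increasing cadlag function. Summing over all \<open>s \<in> {0<..t}\<close> is the
  same as summing over the jump times in \<open>{0<..t}\<close>, since the other terms vanish; the jumps of an
  increasing function on \<open>{0..t}\<close> are summable, so the infinite sum is then never a default value.
\<close>

definition continuous_component :: "(real \<Rightarrow> real) \<Rightarrow> real \<Rightarrow> real" where
  "continuous_component f t = f t - (\<Sum>\<^sub>\<infinity>s\<in>{0<..t}. jump f s)"

text \<open>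
  The event below says that the supremum over \<open>{0..T}\<close> of \<open>\<bar>X \<epsilon> t \<omega> - C t \<omega>\<bar>\<close> exceeds \<open>\<delta>\<close>. Paths are
  only almost surely cadlag and \<open>M\<close> need not be complete, so this event need not be measurable;
  the outer measure agrees with the probability whenever it is.
\<close>

definition ucp_limit ::
  "'a measure \<Rightarrow> real \<Rightarrow> ('i \<Rightarrow> real \<Rightarrow> 'a \<Rightarrow> real) \<Rightarrow> (real \<Rightarrow> 'a \<Rightarrow> real) \<Rightarrow> 'i filter \<Rightarrow> bool" where
  "ucp_limit M T X C F \<longleftrightarrow>
     (\<forall>\<delta>>0. ((\<lambda>\<epsilon>. outer_measure_of M {\<omega>\<in>space M. \<exists>t\<in>{0..T}. \<bar>X \<epsilon> t \<omega> - C t \<omega>\<bar> > \<delta>}) \<longlongrightarrow> 0) F)"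

definition approx_covariation ::
  "(real \<Rightarrow> 'a \<Rightarrow> real) \<Rightarrow> (real \<Rightarrow> 'a \<Rightarrow> real) \<Rightarrow> real \<Rightarrow> real \<Rightarrow> 'a \<Rightarrow> real" where
  "approx_covariation Y Z \<epsilon> t \<omega> =
     1 / \<epsilon> * (LBINT s:{0..t}. (Y (min (s + \<epsilon>) t) \<omega> - Y s \<omega>) * (Z (min (s + \<epsilon>) t) \<omega> - Z s \<omega>))"

text \<open>
  A u.c.p. limit of cadlag processes is almost surely cadlag, so asking for a cadlag limit is no
  restriction.
\<close>

definition is_covariation ::
  "'a measure \<Rightarrow> real \<Rightarrow> (real \<Rightarrow> 'a \<Rightarrow> real) \<Rightarrow> (real \<Rightarrow> 'a \<Rightarrow> real) \<Rightarrow> (real \<Rightarrow> 'a \<Rightarrow> real) \<Rightarrow> bool" where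
  "is_covariation M T Y Z C \<longleftrightarrow>
     cadlag_process M T C \<and> ucp_limit M T (approx_covariation Y Z) C (at_right 0)"

definition covariation_exists ::
  "'a measure \<Rightarrow> real \<Rightarrow> (real \<Rightarrow> 'a \<Rightarrow> real) \<Rightarrow> (real \<Rightarrow> 'a \<Rightarrow> real) \<Rightarrow> bool" where
  "covariation_exists M T Y Z \<longleftrightarrow> (\<exists>C. is_covariation M T Y Z C)"

text \<open>
  The covariation is unique only up to indistinguishability; the choice operator picks a version.
  Identities between processes are accordingly stated almost surely, simultaneously for all times.
\<close>

definition covariation ::
  "'a measure \<Rightarrow> real \<Rightarrow> (real \<Rightarrow> 'a \<Rightarrow> real) \<Rightarrow> (real \<Rightarrow> 'a \<Rightarrow> real) \<Rightarrow> real \<Rightarrow> 'a \<Rightarrow> real" where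
  "covariation M T Y Z = (SOME C. is_covariation M T Y Z C)"

definition finite_quadratic_variation :: "'a measure \<Rightarrow> real \<Rightarrow> (real \<Rightarrow> 'a \<Rightarrow> real) \<Rightarrow> bool" where
  "finite_quadratic_variation M T Y \<longleftrightarrow> covariation_exists M T Y Y"

end

theory Submission
  imports Defs
begin

text \<open>
  Write \<open>B \<epsilon> f g t\<close> for the regularised bracket of two fixed paths \<open>f\<close> and \<open>g\<close>. It is bilinear and
  \<open>B \<epsilon> f f \<ge> 0\<close>. The argument is pathwise, along a sequence \<open>\<epsilon>\<^sub>n \<rightarrow> 0\<close> for which the brackets of \<open>(Y, Y)\<close>
  and of \<open>(Z, Z)\<close> converge uniformly on \<open>{0..T}\<close> for almost every \<open>\<omega>\<close>.

  The bracket of a step function, equal to \<open>1\<close> from time \<open>c\<close> on and to \<open>0\<close> before, with any cadlag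
  \<open>g\<close> converges, uniformly in \<open>t\<close>, to the jump of \<open>g\<close> at \<open>c\<close> switched on at time \<open>c\<close>
  (\<open>bracket_step_limit\<close>). By bilinearity, one may subtract finitely many jumps of \<open>f\<close> at the times in \<open>J\<close>:
  the remainder \<open>h\<close> satisfies \<open>B \<epsilon>\<^sub>n h h \<rightarrow> [f, f] - \<Sum>\<close> of the squared jumps in \<open>J\<close>
  (\<open>bracket_remove_jumps_limit\<close>). Positivity makes the squared jumps summable, and the jumps of
  \<open>[f, f]\<close> are the squared jumps of \<open>f\<close> (\<open>jump_quadratic_variation\<close>). If \<open>[f, f]\<close> has no continuous
  component, then it is the sum of the squared jumps, so that \<open>B \<epsilon>\<^sub>n h h\<close> is eventually as small as
  desired once \<open>J\<close> is large. As \<open>2 \<bar>B \<epsilon> h g\<bar> \<le> \<theta> B \<epsilon> h h + B \<epsilon> g g / \<theta>\<close> and \<open>B \<epsilon>\<^sub>n g g\<close> stays bounded, the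
  continuous part of \<open>[g, g]\<close> does no harm: \<open>B \<epsilon>\<^sub>n h g\<close> is small, and \<open>B \<epsilon>\<^sub>n f g\<close> converges to the sum of
  the products of jumps (\<open>pure_jump_bracket_limit\<close>).

  Passing between u.c.p. and almost sure uniform convergence needs care because the exceptional
  events are measured by an outer measure. Borel-Cantelli applied to measurable covers gives the
  sequences (\<open>ucp_limit_AE_sequence\<close>). In the other direction an outer measure need not be
  continuous along decreasing sequences, and right-continuity in \<open>t\<close> is used to make the exceptional
  events measurable up to null sets (\<open>AE_uniform_limit_imp_outer_measure_limit\<close>).
\<close>

section \<open>Cadlag functions on the real line\<close>

text \<open>
  Evaluating at the next point of the grid of mesh \<open>1 / (n + 1)\<close> gives a process that takes only countably
  many random variables as values in time; right-continuity recovers \<open>X\<close> in the limit.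
\<close>
lemma right_continuous_jointly_measurable:
  fixes X :: "real \<Rightarrow> 'a \<Rightarrow> real"
  assumes meas [measurable]: "\<And>t. X t \<in> borel_measurable M"
    and rc: "\<And>\<omega> t. \<omega> \<in> space M \<Longrightarrow> ((\<lambda>s. X s \<omega>) \<longlongrightarrow> X t \<omega>) (at_right t)"
  shows "(\<lambda>(s, \<omega>). X s \<omega>) \<in> borel_measurable (borel \<Otimes>\<^sub>M M)"
proof -
  define r where "r n s = (real_of_int \<lfloor>real (Suc n) * s\<rfloor> + 1) / real (Suc n)" for n and s :: real
  have r_gt: "s < r n s" for n s
    unfolding r_def by (simp add: field_simps) linarith
  have r_le: "r n s \<le> s + 1 / real (Suc n)" for n s
  proof -
    have "r n s \<le> (real (Suc n) * s + 1) / real (Suc n)"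
      unfolding r_def by (intro divide_right_mono add_right_mono of_int_floor_le) auto
    also have "\<dots> = s + 1 / real (Suc n)" by (simp add: add_divide_distrib)
    finally show ?thesis .
  qed
  have r_lim: "(\<lambda>n. r n s) \<longlonglongrightarrow> s" for s
  proof (rule tendsto_sandwich)
    show "\<forall>\<^sub>F n in sequentially. s \<le> r n s" by (intro always_eventually allI less_imp_le r_gt)
    show "\<forall>\<^sub>F n in sequentially. r n s \<le> s + 1 / real (Suc n)" by (intro always_eventually allI r_le)
    show "(\<lambda>n. s + 1 / real (Suc n)) \<longlonglongrightarrow> s"
      using tendsto_add[OF tendsto_const LIMSEQ_inverse_real_of_nat, of s] by (simp add: field_simps)
  qed simp
  have r_right: "filterlim (\<lambda>n. r n s) (at_right s) sequentially" for s
    unfolding filterlim_at using r_lim less_imp_neq[OF r_gt, symmetric]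
    by (auto intro!: always_eventually r_gt)
  \<comment> \<open>The integer part takes countably many values, so measurability may be checked for each of them.\<close>
  have "(\<lambda>p. case p of (s, \<omega>) \<Rightarrow> X (r n s) \<omega>) \<in> borel_measurable (borel \<Otimes>\<^sub>M M)" for n
  proof -
    have "(\<lambda>p. (\<lambda>(i::int) p. X ((real_of_int i + 1) / real (Suc n)) (snd p))
        \<lfloor>real (Suc n) * fst p\<rfloor> p) \<in> borel_measurable (borel \<Otimes>\<^sub>M M)"
      by (rule measurable_compose_countable) measurable
    then show ?thesis by (simp add: r_def case_prod_beta)
  qed
  then show ?thesis
  proof (rule borel_measurable_LIMSEQ_real[rotated])
    fix p assume "p \<in> space ((borel :: real measure) \<Otimes>\<^sub>M M)"
    then show "(\<lambda>n. case p of (s, \<omega>) \<Rightarrow> X (r n s) \<omega>) \<longlonglongrightarrow> (case p of (s, \<omega>) \<Rightarrow> X s \<omega>)"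
      by (auto simp: space_pair_measure intro!: filterlim_compose[OF rc r_right])
  qed
qed

text \<open>
  A path on \<open>{0..T}\<close> extends to a function of this kind by constants on either side. Working on the
  whole line avoids distinguishing the end points of the interval.
\<close>
definition cadlag_bounded :: "(real \<Rightarrow> real) \<Rightarrow> bool" where
  "cadlag_bounded f \<longleftrightarrow>
     (\<forall>t. (f \<longlongrightarrow> f t) (at_right t)) \<and> (\<forall>t. \<exists>l. (f \<longlongrightarrow> l) (at_left t)) \<and> (\<exists>K. \<forall>t. \<bar>f t\<bar> \<le> K)"

lemma cadlag_boundedD:
  assumes "cadlag_bounded f"
  shows "(f \<longlongrightarrow> f t) (at_right t)" and "(f \<longlongrightarrow> f t - jump f t) (at_left t)"
proof -
  show "(f \<longlongrightarrow> f t) (at_right t)" using assms by (auto simp: cadlag_bounded_def)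
  obtain l where l: "(f \<longlongrightarrow> l) (at_left t)" using assms unfolding cadlag_bounded_def by blast
  then have "Lim (at_left t) f = l" by (intro tendsto_Lim) auto
  with l show "(f \<longlongrightarrow> f t - jump f t) (at_left t)" by (simp add: jump_def)
qed

lemma jump_eqI:
  assumes "(f \<longlongrightarrow> l) (at_left t)"
  shows "jump f t = f t - l"
  using tendsto_Lim[OF _ assms] by (simp add: jump_def)

lemma cadlag_bounded_measurable [measurable_dest]:
  assumes "cadlag_bounded f"
  shows "f \<in> borel_measurable borel"
proof -
  have "(\<lambda>(s, \<omega>). f s) \<in> borel_measurable (borel \<Otimes>\<^sub>M (count_space UNIV :: unit measure))"
    by (rule right_continuous_jointly_measurable) (use cadlag_boundedD(1)[OF assms] in auto)
  from measurable_compose[OF _ this, of "\<lambda>s. (s, ())" borel] show ?thesis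
    by simp
qed

lemma cadlag_bounded_diff:
  assumes "cadlag_bounded f" "cadlag_bounded g"
  shows "cadlag_bounded (\<lambda>s. f s - g s)"
proof -
  obtain K L where "\<And>t. \<bar>f t\<bar> \<le> K" "\<And>t. \<bar>g t\<bar> \<le> L"
    using assms by (auto simp: cadlag_bounded_def)
  then have "\<bar>f t - g t\<bar> \<le> K + L" for t
    using abs_triangle_ineq4[of "f t" "g t"] by (smt (verit))
  then show ?thesis
    unfolding cadlag_bounded_def
    using tendsto_diff[OF assms[THEN cadlag_boundedD(1)]] tendsto_diff[OF assms[THEN cadlag_boundedD(2)]]
    by blast
qed

lemma cadlag_bounded_scale:
  assumes "cadlag_bounded f"
  shows "cadlag_bounded (\<lambda>s. a * f s)"
proof -
  obtain K where "\<And>t. \<bar>f t\<bar> \<le> K"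
    using assms by (auto simp: cadlag_bounded_def)
  then have "\<bar>a * f t\<bar> \<le> \<bar>a\<bar> * K" for t
    by (simp add: abs_mult mult_left_mono)
  then show ?thesis
    unfolding cadlag_bounded_def
    using tendsto_mult_left[OF assms[THEN cadlag_boundedD(1)]] tendsto_mult_left[OF assms[THEN cadlag_boundedD(2)]]
    by blast
qed

lemma step_left_limit:
  fixes c t :: real
  shows "((\<lambda>s. of_bool (c \<le> s) :: real) \<longlongrightarrow> of_bool (c < t)) (at_left t)"
proof (cases "c < t")
  case True
  have "eventually (\<lambda>s. of_bool (c \<le> s) = (1::real)) (at_left t)"
    using True by (intro eventually_at_leftI[of c]) auto
  then show ?thesis using True by (simp add: tendsto_eventually)
next
  case False
  have "eventually (\<lambda>s. of_bool (c \<le> s) = (0::real)) (at_left t)"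
    using False by (intro eventually_at_leftI[of "t - 1"]) auto
  then show ?thesis using False by (simp add: tendsto_eventually)
qed

lemma cadlag_bounded_step: "cadlag_bounded (\<lambda>s. of_bool (c \<le> s))"
proof -
  have "((\<lambda>s. of_bool (c \<le> s)) \<longlongrightarrow> (of_bool (c \<le> t) :: real)) (at_right t)" for t
  proof (rule tendsto_eventually, cases "c \<le> t")
    case True
    then show "eventually (\<lambda>s. of_bool (c \<le> s) = (of_bool (c \<le> t) :: real)) (at_right t)"
      by (auto simp: eventually_at_filter)
  next
    case False
    then have "t < c" by simp
    then show "eventually (\<lambda>s. of_bool (c \<le> s) = (of_bool (c \<le> t) :: real)) (at_right t)"
      by (intro eventually_at_rightI[of t c]) auto
  qed
  moreover have "\<bar>of_bool (c \<le> t) :: real\<bar> \<le> 1" for t by simp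
  ultimately show ?thesis
    unfolding cadlag_bounded_def using step_left_limit by blast
qed

lemma cadlag_bounded_sum:
  assumes "\<And>i. i \<in> I \<Longrightarrow> cadlag_bounded (f i)"
  shows "cadlag_bounded (\<lambda>s. \<Sum>i\<in>I. f i s)"
  using assms
proof (induction I rule: infinite_finite_induct)
  case (insert i I)
  then have "cadlag_bounded (\<lambda>s. f i s - (-1) * (\<Sum>i\<in>I. f i s))"
    by (intro cadlag_bounded_diff cadlag_bounded_scale) auto
  with insert show ?case by simp
qed (auto simp: cadlag_bounded_def)

section \<open>The regularised bracket of two paths\<close>
definition bracket :: "(real \<Rightarrow> real) \<Rightarrow> (real \<Rightarrow> real) \<Rightarrow> real \<Rightarrow> real \<Rightarrow> real" where
  "bracket f g \<epsilon> t =
     1 / \<epsilon> * (LBINT s:{0..t}. (f (min (s + \<epsilon>) t) - f s) * (g (min (s + \<epsilon>) t) - g s))"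

lemma increment_product_bound:
  fixes x y :: real
  assumes "\<bar>x\<bar> \<le> K" "\<bar>x'\<bar> \<le> K" "\<bar>y\<bar> \<le> L" "\<bar>y'\<bar> \<le> L"
  shows "\<bar>(x - x') * (y - y')\<bar> \<le> (2 * K) * (2 * L)"
proof -
  have "\<bar>x - x'\<bar> \<le> 2 * K" "\<bar>y - y'\<bar> \<le> 2 * L" using assms by linarith+
  then show ?thesis unfolding abs_mult by (intro mult_mono) linarith+
qed

lemma bracket_integrable:
  assumes "cadlag_bounded f" "cadlag_bounded g"
  shows "set_integrable lborel {0..t} (\<lambda>s. (f (min (s + \<epsilon>) t) - f s) * (g (min (s + \<epsilon>) t) - g s))"
proof -
  note [measurable] = assms[THEN cadlag_bounded_measurable]
  obtain K L where K: "\<And>t. \<bar>f t\<bar> \<le> K" and L: "\<And>t. \<bar>g t\<bar> \<le> L"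
    using assms by (auto simp: cadlag_bounded_def)
  show ?thesis unfolding set_integrable_def
  proof (rule integrableI_bounded_set_indicator)
    show "AE s in lborel. s \<in> {0..t} \<longrightarrow>
        norm ((f (min (s + \<epsilon>) t) - f s) * (g (min (s + \<epsilon>) t) - g s)) \<le> (2 * K) * (2 * L)"
      using increment_product_bound[OF K K L L] by simp
  qed (auto simp: emeasure_lborel_Icc_eq)
qed

lemma bracket_diff_left:
  assumes "cadlag_bounded f" "cadlag_bounded h" "cadlag_bounded g"
  shows "bracket (\<lambda>s. f s - h s) g \<epsilon> t = bracket f g \<epsilon> t - bracket h g \<epsilon> t"
proof -
  have "(LBINT s:{0..t}. ((f (min (s + \<epsilon>) t) - h (min (s + \<epsilon>) t)) - (f s - h s)) * (g (min (s + \<epsilon>) t) - g s))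
     = (LBINT s:{0..t}. (f (min (s + \<epsilon>) t) - f s) * (g (min (s + \<epsilon>) t) - g s)
          - (h (min (s + \<epsilon>) t) - h s) * (g (min (s + \<epsilon>) t) - g s))"
    by (simp add: algebra_simps)
  also have "\<dots> = (LBINT s:{0..t}. (f (min (s + \<epsilon>) t) - f s) * (g (min (s + \<epsilon>) t) - g s))
          - (LBINT s:{0..t}. (h (min (s + \<epsilon>) t) - h s) * (g (min (s + \<epsilon>) t) - g s))"
    by (intro set_integral_diff bracket_integrable assms)
  finally show ?thesis by (simp add: bracket_def right_diff_distrib)
qed

lemma bracket_scale_left: "bracket (\<lambda>s. a * f s) g \<epsilon> t = a * bracket f g \<epsilon> t"
proof -
  have "(LBINT s:{0..t}. (a * f (min (s + \<epsilon>) t) - a * f s) * (g (min (s + \<epsilon>) t) - g s))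
     = (LBINT s:{0..t}. a * ((f (min (s + \<epsilon>) t) - f s) * (g (min (s + \<epsilon>) t) - g s)))"
    by (simp add: algebra_simps)
  then show ?thesis by (simp add: bracket_def)
qed

lemma bracket_commute: "bracket f g \<epsilon> t = bracket g f \<epsilon> t"
  by (simp add: bracket_def mult.commute)

lemma bracket_zero_left: "bracket (\<lambda>s. 0) g \<epsilon> t = 0"
  by (simp add: bracket_def set_lebesgue_integral_def)

lemma bracket_sum_left:
  assumes "\<And>i. i \<in> I \<Longrightarrow> cadlag_bounded (f i)" "cadlag_bounded g"
  shows "bracket (\<lambda>s. \<Sum>i\<in>I. f i s) g \<epsilon> t = (\<Sum>i\<in>I. bracket (f i) g \<epsilon> t)"
  using assms(1)
proof (induction I rule: infinite_finite_induct)
  case (insert i I)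
  have "bracket (\<lambda>s. f i s - (-1) * (\<Sum>i\<in>I. f i s)) g \<epsilon> t
      = bracket (f i) g \<epsilon> t - (-1) * bracket (\<lambda>s. \<Sum>i\<in>I. f i s) g \<epsilon> t"
    unfolding bracket_scale_left[symmetric] using insert assms(2)
    by (intro bracket_diff_left cadlag_bounded_scale cadlag_bounded_sum) auto
  with insert show ?case by simp
qed (auto simp: bracket_zero_left)

lemma bracket_nonneg: "\<epsilon> > 0 \<Longrightarrow> bracket f f \<epsilon> t \<ge> 0"
  by (auto simp: bracket_def set_lebesgue_integral_def intro!: divide_nonneg_pos integral_nonneg)

text \<open>
  A substitute for the Cauchy-Schwarz inequality: expand the nonnegative bracket of
  \<open>f \<plusminus> g / \<theta>\<close> with itself. The weight \<open>\<theta>\<close> allows a small bracket of \<open>f\<close> to beat a merely bounded one of \<open>g\<close>.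
\<close>
lemma bracket_weighted_bound:
  assumes "cadlag_bounded f" "cadlag_bounded g" "\<epsilon> > 0" "\<theta> > 0"
  shows "2 * \<bar>bracket f g \<epsilon> t\<bar> \<le> \<theta> * bracket f f \<epsilon> t + bracket g g \<epsilon> t / \<theta>"
proof -
  have *: "2 * (\<sigma> * bracket f g \<epsilon> t) \<le> \<theta> * bracket f f \<epsilon> t + bracket g g \<epsilon> t / \<theta>"
    if "\<sigma> = 1 \<or> \<sigma> = -1" for \<sigma> :: real
  proof -
    let ?h = "\<lambda>s. f s - \<sigma> / \<theta> * g s"
    have h: "cadlag_bounded ?h" by (intro cadlag_bounded_diff cadlag_bounded_scale assms)
    have scg: "cadlag_bounded (\<lambda>s. \<sigma> / \<theta> * g s)" by (intro cadlag_bounded_scale assms)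
    have [simp]: "\<sigma> * \<sigma> = 1" using that by auto
    have "bracket ?h ?h \<epsilon> t = bracket f ?h \<epsilon> t - \<sigma> / \<theta> * bracket g ?h \<epsilon> t"
      using bracket_diff_left[OF assms(1) scg h] bracket_scale_left by metis
    also have "bracket f ?h \<epsilon> t = bracket f f \<epsilon> t - \<sigma> / \<theta> * bracket f g \<epsilon> t"
      using bracket_diff_left[OF assms(1) scg assms(1)] bracket_scale_left bracket_commute by metis
    also have "bracket g ?h \<epsilon> t = bracket f g \<epsilon> t - \<sigma> / \<theta> * bracket g g \<epsilon> t"
      using bracket_diff_left[OF assms(1) scg assms(2)] bracket_scale_left bracket_commute by metis
    finally have "0 \<le> \<theta> * (bracket f f \<epsilon> t - \<sigma> / \<theta> * bracket f g \<epsilon> t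
        - \<sigma> / \<theta> * (bracket f g \<epsilon> t - \<sigma> / \<theta> * bracket g g \<epsilon> t))"
      using bracket_nonneg[OF assms(3), of ?h t] assms(4) by simp
    also have "\<dots> = \<theta> * bracket f f \<epsilon> t - 2 * (\<sigma> * bracket f g \<epsilon> t) + \<sigma> * \<sigma> * bracket g g \<epsilon> t / \<theta>"
      using assms(4) by (simp add: field_simps)
    finally show ?thesis by simp
  qed
  from *[of 1] *[of "-1"] show ?thesis by linarith
qed

lemma bracket_cong:
  assumes "\<epsilon> \<ge> 0" "\<And>s. s \<in> {0..t} \<Longrightarrow> f s = f' s" "\<And>s. s \<in> {0..t} \<Longrightarrow> g s = g' s"
  shows "bracket f g \<epsilon> t = bracket f' g' \<epsilon> t"
  unfolding bracket_def using assms
  by (intro arg_cong2[where f = "(*)"] refl set_lebesgue_integral_cong) auto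

section \<open>Limits of brackets with step functions\<close>
lemma average_close:
  fixes h :: "real \<Rightarrow> real"
  assumes "set_integrable lborel {a..<b} h" "a < b" "\<And>s. s \<in> {a..<b} \<Longrightarrow> \<bar>h s - m\<bar> \<le> \<eta>"
  shows "\<bar>1 / (b - a) * (LBINT s:{a..<b}. h s) - m\<bar> \<le> \<eta>"
proof -
  have c: "set_integrable lborel {a..<b} (\<lambda>s. k)" for k :: real
    unfolding set_integrable_def by (rule integrableI_bounded_set_indicator[where B = "\<bar>k\<bar>"]) (use assms in auto)
  have ck: "(LBINT s:{a..<b}. k) = (b - a) * k" for k :: real
    using assms(2) by (subst set_integral_const) auto
  have "\<bar>(LBINT s:{a..<b}. h s) - (b - a) * m\<bar> = \<bar>LBINT s:{a..<b}. h s - m\<bar>"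
    using set_integral_diff(2)[OF assms(1) c[of m]] ck[of m] by simp
  also have "\<dots> \<le> (LBINT s:{a..<b}. \<bar>h s - m\<bar>)"
    using set_integral_norm_bound[OF set_integral_diff(1)[OF assms(1) c[of m]]] by simp
  also have "\<dots> \<le> (LBINT s:{a..<b}. \<eta>)"
    using set_integrable_abs[OF set_integral_diff(1)[OF assms(1) c[of m]]]
    by (intro set_integral_mono c assms(3))
  finally have "\<bar>(LBINT s:{a..<b}. h s) - (b - a) * m\<bar> \<le> (b - a) * \<eta>" by (simp add: ck)
  then have "\<bar>(b - a) * (1 / (b - a) * (LBINT s:{a..<b}. h s) - m)\<bar> \<le> (b - a) * \<eta>"
    using assms(2) by (simp add: right_diff_distrib)
  then show ?thesis using assms(2) by (simp add: abs_mult)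
qed

text \<open>
  For \<open>t \<ge> c\<close> the increment of the step function over \<open>[s, min (s + \<epsilon>) t]\<close> is \<open>1\<close> exactly for \<open>s\<close> in
  \<open>{c - \<epsilon>..<c}\<close>, so the bracket is an average of increments of \<open>g\<close> that start just before \<open>c\<close> and end
  in \<open>[c, c + \<epsilon>]\<close>. Stopping the increments at \<open>t\<close>, instead of letting them run to \<open>s + \<epsilon>\<close>, makes the
  bracket vanish for all \<open>t < c\<close>; this is why the convergence is uniform although the limit jumps.
\<close>
lemma bracket_step_limit:
  assumes g: "cadlag_bounded g" and "c > 0"
  shows "uniform_limit UNIV (\<lambda>\<epsilon> t. bracket (\<lambda>s. of_bool (c \<le> s)) g \<epsilon> t)
    (\<lambda>t. of_bool (c \<le> t) * jump g c) (at_right 0)"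
  unfolding uniform_limit_iff
proof (intro allI impI)
  fix e :: real assume "e > 0"
  note [measurable] = cadlag_bounded_measurable[OF g]
  define l where "l = g c - jump g c"
  have "\<forall>\<^sub>F u in at_right c. dist (g u) (g c) < e / 4"
    using cadlag_boundedD(1)[OF g] \<open>e > 0\<close> by (intro tendstoD) auto
  then obtain b where b: "b > c" "\<And>u. c < u \<Longrightarrow> u < b \<Longrightarrow> \<bar>g u - g c\<bar> < e / 4"
    by (auto simp: eventually_at_right_field dist_real_def)
  have "\<forall>\<^sub>F u in at_left c. dist (g u) l < e / 4"
    using cadlag_boundedD(2)[OF g] \<open>e > 0\<close> unfolding l_def by (intro tendstoD) auto
  then obtain a where a: "a < c" "\<And>u. a < u \<Longrightarrow> u < c \<Longrightarrow> \<bar>g u - l\<bar> < e / 4"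
    by (auto simp: eventually_at_left_field dist_real_def)
  have "\<forall>\<^sub>F \<epsilon> in at_right 0. \<epsilon> \<in> {0<..<min c (min (b - c) (c - a))}"
    using a b \<open>c > 0\<close> by (intro eventually_at_right_real) auto
  then show "\<forall>\<^sub>F \<epsilon> in at_right 0. \<forall>t\<in>UNIV.
      dist (bracket (\<lambda>s. of_bool (c \<le> s)) g \<epsilon> t) (of_bool (c \<le> t) * jump g c) < e"
  proof eventually_elim
    case (elim \<epsilon>)
    show ?case
    proof
      fix t :: real
      show "dist (bracket (\<lambda>s. of_bool (c \<le> s)) g \<epsilon> t) (of_bool (c \<le> t) * jump g c) < e"
      proof (cases "c \<le> t")
        case False
        then have "bracket (\<lambda>s. of_bool (c \<le> s)) g \<epsilon> t = bracket (\<lambda>s. 0) g \<epsilon> t"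
          using elim by (intro bracket_cong) auto
        with False \<open>e > 0\<close> show ?thesis by (simp add: bracket_zero_left)
      next
        case True
        have "bracket (\<lambda>s. of_bool (c \<le> s)) g \<epsilon> t
            = 1 / (c - (c - \<epsilon>)) * (LBINT s:{c-\<epsilon>..<c}. g (min (s + \<epsilon>) t) - g s)"
          unfolding bracket_def set_lebesgue_integral_def using True elim
          by (intro arg_cong2[where f = "(*)"] Bochner_Integration.integral_cong refl) (auto simp: indicator_def)
        moreover have "\<bar>1 / (c - (c - \<epsilon>)) * (LBINT s:{c-\<epsilon>..<c}. g (min (s + \<epsilon>) t) - g s) - jump g c\<bar> \<le> e / 2"
        proof (rule average_close)
          obtain K where "\<And>t. \<bar>g t\<bar> \<le> K" using g by (auto simp: cadlag_bounded_def)
          then have "\<bar>g u - g v\<bar> \<le> 2 * K" for u v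
            using abs_triangle_ineq4[of "g u" "g v"] by (smt (verit))
          then show "set_integrable lborel {c-\<epsilon>..<c} (\<lambda>s. g (min (s + \<epsilon>) t) - g s)"
            unfolding set_integrable_def using elim
            by (intro integrableI_bounded_set_indicator[where B = "2 * K"]) auto
          show "c - \<epsilon> < c" using elim by simp
          fix s assume s: "s \<in> {c-\<epsilon>..<c}"
          then have "\<bar>g s - l\<bar> < e / 4" using a elim by auto
          moreover have "\<bar>g (min (s + \<epsilon>) t) - g c\<bar> < e / 4"
          proof (cases "min (s + \<epsilon>) t = c")
            case False
            then have "c < min (s + \<epsilon>) t" using s True by auto
            moreover have "min (s + \<epsilon>) t < b" using s elim by auto
            ultimately show ?thesis by (rule b)
          qed (use \<open>e > 0\<close> in simp)
          ultimately show "\<bar>g (min (s + \<epsilon>) t) - g s - jump g c\<bar> \<le> e / 2"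
            unfolding l_def by linarith
        qed
        ultimately show ?thesis using True \<open>e > 0\<close> by (simp add: dist_real_def)
      qed
    qed
  qed
qed

text \<open>
  The integrands that define the two brackets agree for \<open>s < c - 2 * \<epsilon>\<close>, and on the remaining interval
  of length \<open>2 * \<epsilon>\<close> both are small, as the path hardly moves there.
\<close>
lemma bracket_increment_at_continuity:
  assumes h: "cadlag_bounded h" and "c > 0" and "jump h c = 0"
  shows "((\<lambda>\<epsilon>. bracket h h \<epsilon> c - bracket h h \<epsilon> (c - \<epsilon>)) \<longlongrightarrow> 0) (at_right 0)"
proof (rule tendstoI)
  fix e :: real assume "e > 0"
  \<comment> \<open>The difference will be bounded by \<open>8 * \<eta>\<^sup>2 \<le> 8 * \<eta>\<close>, which this choice keeps below \<open>e\<close>.\<close>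
  define \<eta> where "\<eta> = min 1 (e / 16)"
  have \<eta>: "\<eta> > 0" "\<eta> \<le> 1" "\<eta> \<le> e / 16" using \<open>e > 0\<close> by (auto simp: \<eta>_def)
  have "\<forall>\<^sub>F u in at_left c. dist (h u) (h c) < \<eta>"
    using cadlag_boundedD(2)[OF h, of c] \<eta> assms(3) by (intro tendstoD) auto
  then obtain a where a: "a < c" "\<And>u. a < u \<Longrightarrow> u < c \<Longrightarrow> \<bar>h u - h c\<bar> < \<eta>"
    by (auto simp: eventually_at_left_field dist_real_def)
  have "\<forall>\<^sub>F \<epsilon> in at_right 0. \<epsilon> \<in> {0<..<min (c / 2) ((c - a) / 2)}"
    using a \<open>c > 0\<close> by (intro eventually_at_right_real) auto
  then show "\<forall>\<^sub>F \<epsilon> in at_right 0. dist (bracket h h \<epsilon> c - bracket h h \<epsilon> (c - \<epsilon>)) 0 < e"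
  proof eventually_elim
    case (elim \<epsilon>)
    define \<phi> where "\<phi> t s = (h (min (s + \<epsilon>) t) - h s) * (h (min (s + \<epsilon>) t) - h s)" for t s
    define D where "D s = indicator {0..c} s * \<phi> c s - indicator {0..c-\<epsilon>} s * \<phi> (c - \<epsilon>) s" for s
    have int: "integrable lborel (\<lambda>s. indicator {0..t} s * \<phi> t s)" for t
      using bracket_integrable[OF h h] by (simp add: set_integrable_def \<phi>_def)
    have near: "\<bar>h u - h c\<bar> \<le> \<eta>" if "u \<in> {c - 2 * \<epsilon>..c}" for u
      using that a(2)[of u] elim \<eta>(1) by (cases "u = c") (auto intro: less_imp_le)
    have small: "0 \<le> \<phi> t s \<and> \<phi> t s \<le> 4 * \<eta>\<^sup>2" if "s \<in> {c - 2 * \<epsilon>..c}" "t \<in> {c - \<epsilon>..c}" for s t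
    proof -
      have "min (s + \<epsilon>) t \<in> {c - 2 * \<epsilon>..c}" using that elim by auto
      then have "\<bar>h (min (s + \<epsilon>) t) - h s\<bar> \<le> 2 * \<eta>"
        using near[OF that(1)] near[of "min (s + \<epsilon>) t"] by linarith
      then have "(h (min (s + \<epsilon>) t) - h s)\<^sup>2 \<le> (2 * \<eta>)\<^sup>2"
        by (rule power2_le_iff_abs_le[THEN iffD2, rotated]) (use \<eta> in simp)
      then show ?thesis by (simp add: \<phi>_def power2_eq_square)
    qed
    have D_bound: "\<bar>D s\<bar> \<le> indicator {c - 2 * \<epsilon>..c} s * (4 * \<eta>\<^sup>2)" for s
    proof (cases "s \<in> {c - 2 * \<epsilon>..c}")
      case True
      then show ?thesis
        using small[of s c] small[of s "c - \<epsilon>"] elim by (auto simp: D_def indicator_def)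
    next
      case False
      then have "D s = 0" using elim by (auto simp: D_def \<phi>_def indicator_def)
      then show ?thesis by (simp add: indicator_def)
    qed
    have "bracket h h \<epsilon> c - bracket h h \<epsilon> (c - \<epsilon>) = 1 / \<epsilon> * (LBINT s. D s)"
      unfolding D_def
      by (subst Bochner_Integration.integral_diff[OF int int])
        (simp add: bracket_def set_lebesgue_integral_def \<phi>_def right_diff_distrib)
    moreover have "\<bar>LBINT s. D s\<bar> \<le> (LBINT s. indicator {c - 2 * \<epsilon>..c} s * (4 * \<eta>\<^sup>2))"
      unfolding real_norm_def[symmetric]
    proof (rule Bochner_Integration.integral_norm_bound_integral)
      show "integrable lborel D" unfolding D_def by (intro Bochner_Integration.integrable_diff int)
      show "integrable lborel (\<lambda>s. indicator {c - 2 * \<epsilon>..c} s * (4 * \<eta>\<^sup>2))"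
        by (intro integrable_mult_left integrable_real_indicator) (auto simp: emeasure_lborel_Icc_eq)
    qed (use D_bound in simp)
    moreover have "(LBINT s. indicator {c - 2 * \<epsilon>..c} s * (4 * \<eta>\<^sup>2)) = 8 * \<eta>\<^sup>2 * \<epsilon>"
      using elim by simp
    ultimately have "\<bar>bracket h h \<epsilon> c - bracket h h \<epsilon> (c - \<epsilon>)\<bar> \<le> 1 / \<epsilon> * (8 * \<eta>\<^sup>2 * \<epsilon>)"
      using elim by (simp only: abs_mult) (intro mult_mono, auto)
    also have "\<dots> = 8 * \<eta>\<^sup>2" using elim by simp
    also have "\<eta>\<^sup>2 \<le> 1 * (e / 16)" unfolding power2_eq_square using \<eta> by (intro mult_mono) auto
    finally show ?case using \<open>e > 0\<close> by simp
  qed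
qed

section \<open>Removing finitely many jumps\<close>
definition remove_jumps :: "real set \<Rightarrow> (real \<Rightarrow> real) \<Rightarrow> real \<Rightarrow> real" where
  "remove_jumps J f s = f s - (\<Sum>c\<in>J. jump f c * of_bool (c \<le> s))"

lemma cadlag_bounded_remove_jumps: "cadlag_bounded f \<Longrightarrow> cadlag_bounded (remove_jumps J f)"
  unfolding remove_jumps_def
  by (intro cadlag_bounded_diff cadlag_bounded_sum cadlag_bounded_scale cadlag_bounded_step)

lemma jump_remove_jumps:
  assumes f: "cadlag_bounded f" and "finite J" and "c \<in> J"
  shows "jump (remove_jumps J f) c = 0"
proof -
  have "(remove_jumps J f \<longlongrightarrow> f c - jump f c - (\<Sum>d\<in>J. jump f d * of_bool (d < c))) (at_left c)"
    unfolding remove_jumps_def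
    by (intro tendsto_diff tendsto_sum tendsto_mult_left step_left_limit cadlag_boundedD f)
  then have "jump (remove_jumps J f) c = jump f c
      - (\<Sum>d\<in>J. jump f d * of_bool (d \<le> c) - jump f d * of_bool (d < c))"
    by (subst jump_eqI) (auto simp: remove_jumps_def sum_subtractf)
  also have "(\<Sum>d\<in>J. jump f d * of_bool (d \<le> c) - jump f d * of_bool (d < c))
      = (\<Sum>d\<in>J. if d = c then jump f c else 0)"
    by (intro sum.cong) auto
  finally show ?thesis using assms by simp
qed

lemma bracket_remove_jumps_left:
  assumes "cadlag_bounded f" "cadlag_bounded g"
  shows "bracket (remove_jumps J f) g \<epsilon> t
    = bracket f g \<epsilon> t - (\<Sum>c\<in>J. jump f c * bracket (\<lambda>s. of_bool (c \<le> s)) g \<epsilon> t)"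
  unfolding remove_jumps_def
  using assms
  by (subst bracket_diff_left; (subst bracket_sum_left)?)
    (auto simp: bracket_scale_left intro!: cadlag_bounded_sum cadlag_bounded_scale cadlag_bounded_step)

lemma uniform_limit_sum:
  fixes f :: "'i \<Rightarrow> 'n \<Rightarrow> 'x \<Rightarrow> 'b::real_normed_vector"
  assumes "\<And>i. i \<in> I \<Longrightarrow> uniform_limit S (f i) (l i) F"
  shows "uniform_limit S (\<lambda>n x. \<Sum>i\<in>I. f i n x) (\<lambda>x. \<Sum>i\<in>I. l i x) F"
  using assms
proof (induction I rule: infinite_finite_induct)
  case (insert i I)
  then show ?case by (simp add: uniform_limit_add)
qed (auto intro: uniform_limit_const)

lemma bracket_jumps_limit:
  assumes "cadlag_bounded g" "J \<subseteq> {0<..}" "filterlim e (at_right 0) F"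
  shows "uniform_limit S (\<lambda>n t. \<Sum>c\<in>J. a c * bracket (\<lambda>s. of_bool (c \<le> s)) g (e n) t)
    (\<lambda>t. \<Sum>c\<in>J. a c * (of_bool (c \<le> t) * jump g c)) F"
proof (intro uniform_limit_sum bounded_linear.uniform_limit[OF bounded_linear_mult_right])
  fix c assume "c \<in> J"
  then have "uniform_limit UNIV (\<lambda>n t. bracket (\<lambda>s. of_bool (c \<le> s)) g (e n) t)
      (\<lambda>t. of_bool (c \<le> t) * jump g c) F"
    using assms by (intro filterlim_compose[OF bracket_step_limit assms(3)]) auto
  then show "uniform_limit S (\<lambda>n t. bracket (\<lambda>s. of_bool (c \<le> s)) g (e n) t)
      (\<lambda>t. of_bool (c \<le> t) * jump g c) F"
    by (rule uniform_limit_on_subset) simp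
qed

text \<open>
  With \<open>h = remove_jumps J f\<close>, the difference between the brackets of \<open>(f, f)\<close> and of \<open>(h, h)\<close> consists of
  brackets of steps with \<open>f\<close>, which produce the squared jumps, and of steps with \<open>h\<close>, which vanish in
  the limit because \<open>h\<close> does not jump at the times in \<open>J\<close>.
\<close>
lemma bracket_remove_jumps_limit:
  assumes f: "cadlag_bounded f" and J: "finite J" "J \<subseteq> {0<..}"
    and e: "filterlim e (at_right 0) F"
    and A: "uniform_limit S (\<lambda>n t. bracket f f (e n) t) A F"
  shows "uniform_limit S (\<lambda>n t. bracket (remove_jumps J f) (remove_jumps J f) (e n) t)
    (\<lambda>t. A t - (\<Sum>c\<in>J. of_bool (c \<le> t) * (jump f c)\<^sup>2)) F"
proof -
  let ?h = "remove_jumps J f"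
  let ?B = "\<lambda>g n t. \<Sum>c\<in>J. jump f c * bracket (\<lambda>s. of_bool (c \<le> s)) g (e n) t"
  have h: "cadlag_bounded ?h" by (rule cadlag_bounded_remove_jumps[OF f])
  have "bracket ?h ?h (e n) t = bracket f f (e n) t - ?B f n t - ?B ?h n t" for n t
    using bracket_remove_jumps_left[OF f h, of J "e n" t] bracket_remove_jumps_left[OF f f, of J "e n" t]
      bracket_commute[of f ?h]
    by simp
  moreover have "uniform_limit S (\<lambda>n t. bracket f f (e n) t - ?B f n t - ?B ?h n t)
      (\<lambda>t. A t - (\<Sum>c\<in>J. jump f c * (of_bool (c \<le> t) * jump f c))
        - (\<Sum>c\<in>J. jump f c * (of_bool (c \<le> t) * jump ?h c))) F"
    by (intro uniform_limit_minus A bracket_jumps_limit f h J e)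
  moreover have "(\<Sum>c\<in>J. jump f c * (of_bool (c \<le> t) * jump ?h c)) = 0" for t
    using jump_remove_jumps[OF f J(1)] by simp
  moreover have "(\<Sum>c\<in>J. jump f c * (of_bool (c \<le> t) * jump f c))
      = (\<Sum>c\<in>J. of_bool (c \<le> t) * (jump f c)\<^sup>2)" for t
    by (simp add: power2_eq_square algebra_simps)
  ultimately show ?thesis by simp
qed

text \<open>
  Subtracting the jump at \<open>c\<close> changes nothing before \<open>c\<close> and leaves a path that is continuous at \<open>c\<close>; only
  the brackets with the step function at \<open>c\<close> contribute.
\<close>
lemma bracket_increment_at_jump:
  assumes f: "cadlag_bounded f" and "c > 0"
  shows "((\<lambda>\<epsilon>. bracket f f \<epsilon> c - bracket f f \<epsilon> (c - \<epsilon>)) \<longlongrightarrow> (jump f c)\<^sup>2) (at_right 0)"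
proof -
  define h where "h = remove_jumps {c} f"
  let ?\<iota> = "\<lambda>s. of_bool (c \<le> s) :: real"
  have h: "cadlag_bounded h" unfolding h_def by (rule cadlag_bounded_remove_jumps[OF f])
  have jh: "jump h c = 0" unfolding h_def by (rule jump_remove_jumps[OF f]) auto
  have lim: "((\<lambda>\<epsilon>. bracket ?\<iota> g \<epsilon> c) \<longlongrightarrow> jump g c) (at_right 0)" if "cadlag_bounded g" for g
    using tendsto_uniform_limitI[OF bracket_step_limit[OF that \<open>c > 0\<close>], of c] by simp
  have "bracket f f \<epsilon> c
      = bracket h h \<epsilon> c + jump f c * bracket ?\<iota> h \<epsilon> c + jump f c * bracket ?\<iota> f \<epsilon> c" for \<epsilon>
    using bracket_remove_jumps_left[OF f h, of "{c}" \<epsilon> c]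
      bracket_remove_jumps_left[OF f f, of "{c}" \<epsilon> c] bracket_commute[of f h]
    by (simp add: h_def)
  moreover have "\<forall>\<^sub>F \<epsilon> in at_right 0. bracket f f \<epsilon> (c - \<epsilon>) = bracket h h \<epsilon> (c - \<epsilon>)"
    using eventually_at_right_less[of 0]
    by eventually_elim (intro bracket_cong, auto simp: h_def remove_jumps_def)
  moreover have "((\<lambda>\<epsilon>. (bracket h h \<epsilon> c - bracket h h \<epsilon> (c - \<epsilon>)) + jump f c * bracket ?\<iota> h \<epsilon> c
      + jump f c * bracket ?\<iota> f \<epsilon> c) \<longlongrightarrow> 0 + jump f c * jump h c + jump f c * jump f c) (at_right 0)"
    by (intro tendsto_add tendsto_mult_left lim f h
        bracket_increment_at_continuity[OF h \<open>c > 0\<close> jh])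
  ultimately show ?thesis
    by (auto simp: jh power2_eq_square elim!: Lim_transform_eventually eventually_mono)
qed

section \<open>The jumps of a quadratic variation\<close>

text \<open>
  The bracket of the path without the jumps in \<open>J\<close> is nonnegative, and so is its limit.
\<close>
lemma sum_jumps_squared_le:
  assumes f: "cadlag_bounded f" and J: "finite J" "J \<subseteq> {0<..t}" and "t \<in> S"
    and e: "filterlim e (at_right 0) F" and "F \<noteq> bot"
    and A: "uniform_limit S (\<lambda>n t. bracket f f (e n) t) A F"
  shows "(\<Sum>c\<in>J. (jump f c)\<^sup>2) \<le> A t"
proof -
  have "J \<subseteq> {0<..}" using J by auto
  from tendsto_uniform_limitI[OF bracket_remove_jumps_limit[OF f J(1) this e A] \<open>t \<in> S\<close>]
  have "0 \<le> A t - (\<Sum>c\<in>J. of_bool (c \<le> t) * (jump f c)\<^sup>2)"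
  proof (rule tendsto_lowerbound)
    have "\<forall>\<^sub>F n in F. e n > 0"
      using e by (auto simp: filterlim_at elim: eventually_mono)
    then show "\<forall>\<^sub>F n in F. 0 \<le> bracket (remove_jumps J f) (remove_jumps J f) (e n) t"
      by eventually_elim (rule bracket_nonneg)
  qed fact
  also have "(\<Sum>c\<in>J. of_bool (c \<le> t) * (jump f c)\<^sup>2) = (\<Sum>c\<in>J. (jump f c)\<^sup>2)"
    using J by (intro sum.cong) auto
  finally show ?thesis by simp
qed

text \<open>
  Uniform convergence permits evaluation at the moving time \<open>c - e n\<close>, which approaches \<open>c\<close> from the
  left: the increments of the brackets over \<open>[c - e n, c]\<close> converge to the jump of their limit \<open>A\<close>.
\<close>
lemma jump_quadratic_variation:
  assumes f: "cadlag_bounded f" and c: "c \<in> {0<..T}"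
    and e: "filterlim e (at_right 0) F" and "F \<noteq> bot"
    and A: "uniform_limit {0..T} (\<lambda>n t. bracket f f (e n) t) A F"
    and l: "(A \<longlongrightarrow> l) (at_left c)"
  shows "jump A c = (jump f c)\<^sup>2"
proof -
  have "c > 0" using c by simp
  have e0: "\<forall>\<^sub>F n in F. e n \<in> {0<..<c}"
    using e eventually_at_right_real[OF \<open>c > 0\<close>] by (auto simp: filterlim_iff)
  have "(e \<longlongrightarrow> 0) F" using e by (simp add: filterlim_at)
  then have "((\<lambda>n. c - e n) \<longlongrightarrow> c) F" using tendsto_diff[OF tendsto_const[of c], of e 0 F] by simp
  then have left: "filterlim (\<lambda>n. c - e n) (at_left c) F"
    unfolding filterlim_at using e0 by (auto elim: eventually_mono)
  have "((\<lambda>n. bracket f f (e n) (c - e n) - A (c - e n)) \<longlongrightarrow> 0) F"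
  proof (rule tendstoI)
    fix r :: real assume "r > 0"
    from uniform_limitD[OF A this] e0
    show "\<forall>\<^sub>F n in F. dist (bracket f f (e n) (c - e n) - A (c - e n)) 0 < r"
      by eventually_elim (use c in \<open>auto simp: dist_real_def\<close>)
  qed
  from tendsto_add[OF this filterlim_compose[OF l left]]
  have "((\<lambda>n. bracket f f (e n) (c - e n)) \<longlongrightarrow> l) F" by simp
  moreover have "((\<lambda>n. bracket f f (e n) c) \<longlongrightarrow> A c) F"
    using tendsto_uniform_limitI[OF A] c by simp
  ultimately have "((\<lambda>n. bracket f f (e n) c - bracket f f (e n) (c - e n)) \<longlongrightarrow> A c - l) F"
    by (intro tendsto_diff)
  moreover have "((\<lambda>n. bracket f f (e n) c - bracket f f (e n) (c - e n)) \<longlongrightarrow> (jump f c)\<^sup>2) F"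
    by (rule filterlim_compose[OF bracket_increment_at_jump[OF f \<open>c > 0\<close>] e])
  ultimately have "A c - l = (jump f c)\<^sup>2" using \<open>F \<noteq> bot\<close> tendsto_unique by blast
  then show ?thesis using jump_eqI[OF l] by simp
qed

text \<open>
  The summability of the squared jumps is what rules out that \<open>continuous_component\<close> vanishes only
  because an infinite sum has its default value.
\<close>
lemma pure_jump_quadratic_variation:
  assumes f: "cadlag_bounded f"
    and e: "filterlim e (at_right 0) F" and "F \<noteq> bot"
    and A: "uniform_limit {0..T} (\<lambda>n t. bracket f f (e n) t) A F"
    and l: "\<And>c. c \<in> {0<..T} \<Longrightarrow> \<exists>l. (A \<longlongrightarrow> l) (at_left c)"
    and t: "t \<in> {0..T}" and pure: "continuous_component A t = 0"
  shows "((\<lambda>s. (jump f s)\<^sup>2) has_sum A t) {0<..t}"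
proof -
  have "(\<lambda>s. (jump f s)\<^sup>2) summable_on {0<..t}"
  proof (rule nonneg_bdd_above_summable_on)
    show "bdd_above (sum (\<lambda>s. (jump f s)\<^sup>2) ` {J. J \<subseteq> {0<..t} \<and> finite J})"
      using sum_jumps_squared_le[OF f _ _ t e \<open>F \<noteq> bot\<close> A] by (intro bdd_aboveI[of _ "A t"]) auto
  qed simp
  moreover have "(\<Sum>\<^sub>\<infinity>s\<in>{0<..t}. jump A s) = (\<Sum>\<^sub>\<infinity>s\<in>{0<..t}. (jump f s)\<^sup>2)"
  proof (rule infsum_cong)
    fix s assume "s \<in> {0<..t}"
    then have s: "s \<in> {0<..T}" using t by auto
    then obtain k where "(A \<longlongrightarrow> k) (at_left s)" using l by blast
    then show "jump A s = (jump f s)\<^sup>2" by (rule jump_quadratic_variation[OF f s e \<open>F \<noteq> bot\<close> A])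
  qed
  moreover have "A t = (\<Sum>\<^sub>\<infinity>s\<in>{0<..t}. jump A s)" using pure by (simp add: continuous_component_def)
  ultimately show ?thesis by (metis has_sum_infsum)
qed

section \<open>Sums over jump times\<close>

text \<open>
  Absolute summability bounds the error on every \<open>X\<close> by the tail over \<open>I - J\<close>. Taking \<open>{0<..t}\<close>
  for \<open>X\<close> gives uniformity in \<open>t\<close>.
\<close>
lemma finite_sums_converge_uniformly:
  fixes w :: "'a \<Rightarrow> real"
  assumes w: "(\<lambda>c. \<bar>w c\<bar>) summable_on I"
  shows "uniform_limit (Pow I) (\<lambda>J X. \<Sum>c\<in>J. of_bool (c \<in> X) * w c) (\<lambda>X. \<Sum>\<^sub>\<infinity>c\<in>X. w c)
    (finite_subsets_at_top I)"
proof (rule uniform_limitI)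
  fix r :: real assume "r > 0"
  let ?P = "\<Sum>\<^sub>\<infinity>c\<in>I. \<bar>w c\<bar>"
  have abs: "(\<lambda>c. \<bar>w c\<bar>) summable_on X" if "X \<subseteq> I" for X
    using w that by (auto intro: summable_on_subset)
  then have sub: "w summable_on X" if "X \<subseteq> I" for X
    using that summable_on_iff_abs_summable_on_real by (metis real_norm_def summable_on_cong)
  have "(sum (\<lambda>c. \<bar>w c\<bar>) \<longlongrightarrow> ?P) (finite_subsets_at_top I)"
    using has_sum_infsum[OF abs[of I]] by (simp add: has_sum_def)
  then have "\<forall>\<^sub>F J in finite_subsets_at_top I. dist (\<Sum>c\<in>J. \<bar>w c\<bar>) ?P < r"
    using \<open>r > 0\<close> by (rule tendstoD)
  moreover have "\<forall>\<^sub>F J in finite_subsets_at_top I. finite J \<and> J \<subseteq> I"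
    by (rule eventually_finite_subsets_at_top_weakI) simp
  ultimately show "\<forall>\<^sub>F J in finite_subsets_at_top I. \<forall>X\<in>Pow I.
      dist (\<Sum>c\<in>J. of_bool (c \<in> X) * w c) (\<Sum>\<^sub>\<infinity>c\<in>X. w c) < r"
  proof eventually_elim
    case (elim J)
    show ?case
    proof
      fix X assume "X \<in> Pow I"
      then have X: "X \<subseteq> I" by simp
      have JX: "finite (J \<inter> X)" using elim by simp
      have "(\<Sum>c\<in>J. of_bool (c \<in> X) * w c) = (\<Sum>c\<in>J \<inter> X. w c)"
        using elim by (intro sum.mono_neutral_cong_right) auto
      then have "(\<Sum>\<^sub>\<infinity>c\<in>X. w c) - (\<Sum>c\<in>J. of_bool (c \<in> X) * w c) = (\<Sum>\<^sub>\<infinity>c\<in>X - J \<inter> X. w c)"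
        using infsum_Diff[OF sub[OF X], of "J \<inter> X"] JX by simp
      moreover have "\<bar>\<Sum>\<^sub>\<infinity>c\<in>X - J \<inter> X. w c\<bar> \<le> (\<Sum>\<^sub>\<infinity>c\<in>X - J \<inter> X. \<bar>w c\<bar>)"
        using norm_infsum_bound[of w "X - J \<inter> X"] abs[of "X - J \<inter> X"] X by auto
      moreover have "\<dots> \<le> (\<Sum>\<^sub>\<infinity>c\<in>I - J. \<bar>w c\<bar>)"
        using X by (intro infsum_mono2 abs) auto
      moreover have "\<dots> = ?P - (\<Sum>c\<in>J. \<bar>w c\<bar>)"
        using infsum_Diff[OF abs[of I], of J] elim by simp
      ultimately show "dist (\<Sum>c\<in>J. of_bool (c \<in> X) * w c) (\<Sum>\<^sub>\<infinity>c\<in>X. w c) < r"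
        using elim by (auto simp: dist_real_def)
    qed
  qed
qed

text \<open>
  The sums over finite sets of jump times are step functions, and one-sided limits pass to a uniform
  limit.
\<close>
lemma cadlag_jump_sum:
  fixes w :: "real \<Rightarrow> real"
  assumes w: "(\<lambda>c. \<bar>w c\<bar>) summable_on {0<..T}"
  shows "cadlag_on T (\<lambda>t. \<Sum>\<^sub>\<infinity>s\<in>{0<..t}. w s)"
proof -
  let ?F = "finite_subsets_at_top {0<..T}"
  let ?S = "\<lambda>J t. \<Sum>c\<in>J. of_bool (c \<in> {0<..t}) * w c"
  note lim = finite_sums_converge_uniformly[OF w]
  have J: "\<forall>\<^sub>F J in ?F. finite J \<and> J \<subseteq> {0<..T}"
    by (rule eventually_finite_subsets_at_top_weakI) simp
  have pull: "uniform_limit R ?S (\<lambda>t. \<Sum>\<^sub>\<infinity>s\<in>{0<..t}. w s) ?F" if "R \<subseteq> {..T}" for R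
    by (rule uniform_limit_compose'[OF lim]) (use that in auto)
  have S: "?S J t = (\<Sum>c\<in>J. of_bool (c \<le> t) * w c)" if "J \<subseteq> {0<..T}" for J t
    using that by (intro sum.cong) auto
  show ?thesis unfolding cadlag_on_def
  proof (intro conjI ballI)
    fix t assume t: "t \<in> {0..<T}"
    show "((\<lambda>t. \<Sum>\<^sub>\<infinity>s\<in>{0<..t}. w s) \<longlongrightarrow> (\<Sum>\<^sub>\<infinity>s\<in>{0<..t}. w s)) (at_right t)"
    proof (rule swap_uniform_limit')
      show "\<forall>\<^sub>F J in ?F. (?S J \<longlongrightarrow> ?S J t) (at_right t)"
        using J
      proof eventually_elim
        case (elim J)
        have "((\<lambda>t. \<Sum>c\<in>J. of_bool (c \<le> t) * w c) \<longlongrightarrow> (\<Sum>c\<in>J. of_bool (c \<le> t) * w c)) (at_right t)"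
          by (intro tendsto_sum tendsto_mult_right cadlag_boundedD(1) cadlag_bounded_step)
        then show ?case using S[of J] elim by simp
      qed
      show "((\<lambda>J. ?S J t) \<longlongrightarrow> (\<Sum>\<^sub>\<infinity>s\<in>{0<..t}. w s)) ?F"
        using t by (intro tendsto_uniform_limitI[OF lim]) auto
      show "uniform_limit {..T} ?S (\<lambda>t. \<Sum>\<^sub>\<infinity>s\<in>{0<..t}. w s) ?F"
        by (rule pull) auto
      show "\<forall>\<^sub>F s in at_right t. s \<in> {..T}"
        using t by (intro eventually_at_rightI[of t T]) auto
    qed simp
  next
    fix t assume t: "t \<in> {0<..T}"
    have "((\<lambda>t. \<Sum>\<^sub>\<infinity>s\<in>{0<..t}. w s) \<longlongrightarrow> (\<Sum>\<^sub>\<infinity>s\<in>{0<..<t}. w s)) (at_left t)"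
    proof (rule swap_uniform_limit')
      show "\<forall>\<^sub>F J in ?F. (?S J \<longlongrightarrow> (\<Sum>c\<in>J. of_bool (c \<in> {0<..<t}) * w c)) (at_left t)"
        using J
      proof eventually_elim
        case (elim J)
        have "((\<lambda>t. \<Sum>c\<in>J. of_bool (c \<le> t) * w c) \<longlongrightarrow> (\<Sum>c\<in>J. of_bool (c < t) * w c)) (at_left t)"
          by (intro tendsto_sum tendsto_mult_right step_left_limit)
        moreover have "(\<Sum>c\<in>J. of_bool (c < t) * w c) = (\<Sum>c\<in>J. of_bool (c \<in> {0<..<t}) * w c)"
          using elim by (intro sum.cong) auto
        ultimately show ?case using S[of J] elim by simp
      qed
      show "((\<lambda>J. \<Sum>c\<in>J. of_bool (c \<in> {0<..<t}) * w c) \<longlongrightarrow> (\<Sum>\<^sub>\<infinity>s\<in>{0<..<t}. w s)) ?F"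
        using t by (intro tendsto_uniform_limitI[OF lim]) auto
      show "uniform_limit {..T} ?S (\<lambda>t. \<Sum>\<^sub>\<infinity>s\<in>{0<..t}. w s) ?F"
        by (rule pull) auto
      show "\<forall>\<^sub>F s in at_left t. s \<in> {..T}"
        using t by (intro eventually_at_leftI[of 0]) auto
    qed simp
    then show "\<exists>l. ((\<lambda>t. \<Sum>\<^sub>\<infinity>s\<in>{0<..t}. w s) \<longlongrightarrow> l) (at_left t)" by blast
  qed
qed

lemma jump_products_summable:
  fixes x y :: "'b \<Rightarrow> real"
  assumes "(\<lambda>s. (x s)\<^sup>2) summable_on I" "(\<lambda>s. (y s)\<^sup>2) summable_on I"
  shows "(\<lambda>s. \<bar>x s * y s\<bar>) summable_on I"
  unfolding real_norm_def[symmetric]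
proof (rule Infinite_Sum.abs_summable_on_comparison_test')
  show "(\<lambda>s. (x s)\<^sup>2 + (y s)\<^sup>2) summable_on I"
    by (intro summable_on_add assms)
  fix s
  have "0 \<le> (\<bar>x s\<bar> - \<bar>y s\<bar>)\<^sup>2" by simp
  then have "2 * (\<bar>x s\<bar> * \<bar>y s\<bar>) \<le> (x s)\<^sup>2 + (y s)\<^sup>2" by (simp add: power2_diff)
  moreover have "0 \<le> \<bar>x s\<bar> * \<bar>y s\<bar>" by simp
  ultimately show "norm (x s * y s) \<le> (x s)\<^sup>2 + (y s)\<^sup>2"
    unfolding real_norm_def abs_mult by linarith
qed

section \<open>The bracket with a pure jump path\<close>

text \<open>
  Split \<open>f\<close> into its jumps in a large finite set \<open>J\<close> and a remainder \<open>h\<close>. The jumps contribute the finite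
  sum of products, whereas the limit of the bracket of \<open>(h, h)\<close> is the sum of the squared jumps
  outside \<open>J\<close>. The weighted bound then controls the bracket of \<open>(h, g)\<close>.
\<close>
lemma pure_jump_bracket_limit:
  assumes f: "cadlag_bounded f" and g: "cadlag_bounded g" and "0 \<le> T"
    and e: "filterlim e (at_right 0) F" and "F \<noteq> bot"
    and A: "uniform_limit {0..T} (\<lambda>n t. bracket f f (e n) t) A F"
    and B: "uniform_limit {0..T} (\<lambda>n t. bracket g g (e n) t) B F"
    and pure: "\<And>t. t \<in> {0..T} \<Longrightarrow> ((\<lambda>s. (jump f s)\<^sup>2) has_sum A t) {0<..t}"
    and K: "\<And>t. t \<in> {0..T} \<Longrightarrow> B t \<le> K"
  shows "(\<lambda>s. \<bar>jump f s * jump g s\<bar>) summable_on {0<..T}"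
    and "uniform_limit {0..T} (\<lambda>n t. bracket f g (e n) t)
      (\<lambda>t. \<Sum>\<^sub>\<infinity>s\<in>{0<..t}. jump f s * jump g s) F"
proof -
  have f2: "(\<lambda>s. (jump f s)\<^sup>2) summable_on {0<..T}"
    using pure[of T] \<open>0 \<le> T\<close> by (auto simp: summable_on_def)
  have g2: "(\<lambda>s. (jump g s)\<^sup>2) summable_on {0<..T}"
  proof (rule nonneg_bdd_above_summable_on)
    show "bdd_above (sum (\<lambda>s. (jump g s)\<^sup>2) ` {J. J \<subseteq> {0<..T} \<and> finite J})"
      using sum_jumps_squared_le[OF g _ _ _ e \<open>F \<noteq> bot\<close> B, of _ T] \<open>0 \<le> T\<close>
      by (intro bdd_aboveI[of _ "B T"]) auto
  qed simp
  show fg: "(\<lambda>s. \<bar>jump f s * jump g s\<bar>) summable_on {0<..T}"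
    by (rule jump_products_summable[OF f2 g2])
  have f2': "(\<lambda>s. \<bar>(jump f s)\<^sup>2\<bar>) summable_on {0<..T}" using f2 by simp
  show "uniform_limit {0..T} (\<lambda>n t. bracket f g (e n) t)
      (\<lambda>t. \<Sum>\<^sub>\<infinity>s\<in>{0<..t}. jump f s * jump g s) F"
  proof (rule uniform_limitI)
    fix r :: real assume "r > 0"
    \<comment> \<open>\<open>L\<close> bounds the bracket of \<open>(g, g)\<close> eventually. The choices of \<open>\<theta>\<close> and \<open>\<zeta>\<close> make both terms of the
      weighted bound, \<open>\<theta> * (2 * \<zeta>)\<close> and \<open>L / \<theta>\<close>, equal to \<open>r / 4\<close>.\<close>
    define L where "L = \<bar>K\<bar> + 1"
    define \<theta> where "\<theta> = 4 * L / r"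
    define \<zeta> where "\<zeta> = r / (8 * \<theta>)"
    have pos: "L > 0" "\<theta> > 0" "\<zeta> > 0" using \<open>r > 0\<close> by (auto simp: L_def \<theta>_def \<zeta>_def add_nonneg_pos)
    have fin: "\<forall>\<^sub>F J in finite_subsets_at_top {0<..T}. finite J \<and> J \<subseteq> {0<..T}"
      by (rule eventually_finite_subsets_at_top_weakI) simp
    have "r / 4 > 0" using \<open>r > 0\<close> by simp
    from fin uniform_limitD[OF finite_sums_converge_uniformly[OF f2'] pos(3)]
      uniform_limitD[OF finite_sums_converge_uniformly[OF fg] this]
    have "\<forall>\<^sub>F J in finite_subsets_at_top {0<..T}. (finite J \<and> J \<subseteq> {0<..T}) \<and>
      (\<forall>X\<in>Pow {0<..T}. dist (\<Sum>c\<in>J. of_bool (c \<in> X) * (jump f c)\<^sup>2) (\<Sum>\<^sub>\<infinity>c\<in>X. (jump f c)\<^sup>2) < \<zeta>) \<and>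
      (\<forall>X\<in>Pow {0<..T}. dist (\<Sum>c\<in>J. of_bool (c \<in> X) * (jump f c * jump g c))
         (\<Sum>\<^sub>\<infinity>c\<in>X. jump f c * jump g c) < r / 4)"
      by eventually_elim blast
    from eventually_happens[OF this] obtain J where J: "finite J" "J \<subseteq> {0<..T}"
      and J1: "\<And>X. X \<subseteq> {0<..T} \<Longrightarrow>
        \<bar>(\<Sum>c\<in>J. of_bool (c \<in> X) * (jump f c)\<^sup>2) - (\<Sum>\<^sub>\<infinity>c\<in>X. (jump f c)\<^sup>2)\<bar> < \<zeta>"
      and J2: "\<And>X. X \<subseteq> {0<..T} \<Longrightarrow>
        \<bar>(\<Sum>c\<in>J. of_bool (c \<in> X) * (jump f c * jump g c)) - (\<Sum>\<^sub>\<infinity>c\<in>X. jump f c * jump g c)\<bar> < r / 4"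
      by (auto simp: dist_real_def)
    let ?h = "remove_jumps J f"
    have J0: "J \<subseteq> {0<..}" using J by auto
    have h: "cadlag_bounded ?h" by (rule cadlag_bounded_remove_jumps[OF f])
    have ind: "(\<Sum>c\<in>J. of_bool (c \<in> {0<..t}) * x c) = (\<Sum>c\<in>J. of_bool (c \<le> t) * x c)"
      for t and x :: "real \<Rightarrow> real"
      using J by (intro sum.cong) auto
    have e0: "\<forall>\<^sub>F n in F. e n > 0"
      using e by (auto simp: filterlim_at elim: eventually_mono)
    from uniform_limitD[OF bracket_remove_jumps_limit[OF f J(1) J0 e A] pos(3)]
      uniform_limitD[OF B zero_less_one]
      uniform_limitD[OF bracket_jumps_limit[OF g J0 e, where S = "{0..T}" and a = "jump f"] \<open>r / 4 > 0\<close>] e0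
    show "\<forall>\<^sub>F n in F. \<forall>t\<in>{0..T}.
        dist (bracket f g (e n) t) (\<Sum>\<^sub>\<infinity>s\<in>{0<..t}. jump f s * jump g s) < r"
    proof eventually_elim
      case (elim n)
      show ?case
      proof
        fix t assume t: "t \<in> {0..T}"
        then have X: "{0<..t} \<subseteq> {0<..T}" by auto
        have "(\<Sum>\<^sub>\<infinity>c\<in>{0<..t}. (jump f c)\<^sup>2) = A t" using infsumI[OF pure[OF t]] .
        with J1[OF X] elim(1) t have hh: "bracket ?h ?h (e n) t \<le> 2 * \<zeta>"
          unfolding ind by (auto simp: dist_real_def dest!: bspec[of _ _ t])
        have gg: "bracket g g (e n) t \<le> L"
          using elim(2) t K[OF t] by (auto simp: dist_real_def L_def dest!: bspec[of _ _ t])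
        have "2 * \<bar>bracket ?h g (e n) t\<bar> \<le> \<theta> * bracket ?h ?h (e n) t + bracket g g (e n) t / \<theta>"
          by (rule bracket_weighted_bound) (use h g elim pos in auto)
        also have "\<dots> \<le> \<theta> * (2 * \<zeta>) + L / \<theta>"
          using hh gg pos by (intro add_mono mult_left_mono divide_right_mono) auto
        also have "\<dots> = r / 2" using pos \<open>r > 0\<close> by (simp add: \<zeta>_def \<theta>_def field_simps)
        finally have hg: "\<bar>bracket ?h g (e n) t\<bar> \<le> r / 4" by simp
        have st: "\<bar>(\<Sum>c\<in>J. jump f c * bracket (\<lambda>s. of_bool (c \<le> s)) g (e n) t)
            - (\<Sum>c\<in>J. of_bool (c \<le> t) * (jump f c * jump g c))\<bar> < r / 4"
          using elim(3) t \<open>r > 0\<close> by (auto simp: dist_real_def mult.left_commute dest!: bspec[of _ _ t])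
        show "dist (bracket f g (e n) t) (\<Sum>\<^sub>\<infinity>s\<in>{0<..t}. jump f s * jump g s) < r"
          using hg st J2[OF X, unfolded ind] bracket_remove_jumps_left[OF f g, of J "e n" t] \<open>r > 0\<close>
          unfolding dist_real_def by linarith
      qed
    qed
  qed
qed

section \<open>Paths on a compact interval\<close>
definition clip :: "real \<Rightarrow> (real \<Rightarrow> real) \<Rightarrow> real \<Rightarrow> real" where
  "clip T f s = f (max 0 (min T s))"

lemma clip_eq [simp]: "s \<in> {0..T} \<Longrightarrow> clip T f s = f s"
  by (simp add: clip_def)

text \<open>
  Boundedness follows from compactness: near each point the one-sided limits bound the function.
\<close>
lemma cadlag_bounded_clip:
  assumes f: "cadlag_on T f" and "T > 0"
  shows "cadlag_bounded (clip T f)"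
proof -
  let ?h = "clip T f"
  have right: "(?h \<longlongrightarrow> ?h t) (at_right t)" for t
  proof -
    consider "t < 0" | "t \<in> {0..<T}" | "t \<ge> T" by fastforce
    then show ?thesis
    proof cases
      case 1
      then have "\<forall>\<^sub>F s in at_right t. ?h s = ?h t"
        by (intro eventually_at_rightI[of t 0]) (use \<open>T > 0\<close> in \<open>auto simp: clip_def\<close>)
      then show ?thesis by (rule tendsto_eventually)
    next
      case 2
      have "\<forall>\<^sub>F s in at_right t. f s = ?h s"
        by (intro eventually_at_rightI[of t T]) (use 2 in auto)
      moreover have "(f \<longlongrightarrow> ?h t) (at_right t)" using f 2 by (simp add: cadlag_on_def)
      ultimately show ?thesis using Lim_transform_eventually by blast
    next
      case 3
      then have "\<forall>\<^sub>F s in at_right t. ?h s = ?h t"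
        by (intro eventually_at_rightI[of t "t + 1"]) (use \<open>T > 0\<close> in \<open>auto simp: clip_def\<close>)
      then show ?thesis by (rule tendsto_eventually)
    qed
  qed
  have left: "\<exists>l. (?h \<longlongrightarrow> l) (at_left t)" for t
  proof -
    consider "t \<le> 0" | "t \<in> {0<..T}" | "t > T" by fastforce
    then show ?thesis
    proof cases
      case 1
      then have "\<forall>\<^sub>F s in at_left t. ?h s = ?h t"
        by (intro eventually_at_leftI[of "t - 1"]) (use \<open>T > 0\<close> in \<open>auto simp: clip_def\<close>)
      then show ?thesis by (blast intro: tendsto_eventually)
    next
      case 2
      have "\<forall>\<^sub>F s in at_left t. f s = ?h s"
        by (intro eventually_at_leftI[of 0]) (use 2 in auto)
      moreover obtain l where "(f \<longlongrightarrow> l) (at_left t)" using f 2 unfolding cadlag_on_def by blast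
      ultimately show ?thesis using Lim_transform_eventually by blast
    next
      case 3
      then have "\<forall>\<^sub>F s in at_left t. ?h s = ?h t"
        by (intro eventually_at_leftI[of T]) (use \<open>T > 0\<close> in \<open>auto simp: clip_def\<close>)
      then show ?thesis by (blast intro: tendsto_eventually)
    qed
  qed
  have "\<exists>K. \<forall>s\<in>{0..T}. \<bar>?h s\<bar> \<le> K"
  proof (rule Bolzano[of 0 T "\<lambda>a b. \<exists>K. \<forall>s\<in>{a..b}. \<bar>?h s\<bar> \<le> K"])
    show "0 \<le> T" using \<open>T > 0\<close> by simp
  next
    fix a b c
    assume "\<exists>K. \<forall>s\<in>{a..b}. \<bar>?h s\<bar> \<le> K" "\<exists>K. \<forall>s\<in>{b..c}. \<bar>?h s\<bar> \<le> K"
    then obtain K L where "\<forall>s\<in>{a..b}. \<bar>?h s\<bar> \<le> K" "\<forall>s\<in>{b..c}. \<bar>?h s\<bar> \<le> L" by blast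
    then have "\<bar>?h s\<bar> \<le> max K L" if "s \<in> {a..c}" for s
      using that by (cases "s \<le> b") (auto simp: le_max_iff_disj)
    then show "\<exists>K. \<forall>s\<in>{a..c}. \<bar>?h s\<bar> \<le> K" by blast
  next
    fix x
    obtain l where l: "(?h \<longlongrightarrow> l) (at_left x)" using left by blast
    have "\<forall>\<^sub>F s in at_left x. dist (?h s) l < 1" by (rule tendstoD[OF l]) simp
    then obtain a where a: "a < x" "\<And>s. a < s \<Longrightarrow> s < x \<Longrightarrow> \<bar>?h s - l\<bar> < 1"
      by (auto simp: eventually_at_left_field dist_real_def)
    have "\<forall>\<^sub>F s in at_right x. dist (?h s) (?h x) < 1" by (rule tendstoD[OF right]) simp
    then obtain b where b: "x < b" "\<And>s. x < s \<Longrightarrow> s < b \<Longrightarrow> \<bar>?h s - ?h x\<bar> < 1"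
      by (auto simp: eventually_at_right_field dist_real_def)
    have near: "\<bar>?h s\<bar> \<le> \<bar>?h x\<bar> + \<bar>l\<bar> + 1" if "a < s" "s < b" for s
    proof -
      consider "s < x" | "s = x" | "s > x" by linarith
      then show ?thesis
      proof cases
        case 1
        then have "\<bar>?h s - l\<bar> < 1" using a that by blast
        then show ?thesis by linarith
      next
        case 3
        then have "\<bar>?h s - ?h x\<bar> < 1" using b that by blast
        then show ?thesis by linarith
      qed simp
    qed
    show "\<exists>d>0. \<forall>u v. u \<le> x \<and> x \<le> v \<and> v - u < d \<longrightarrow> (\<exists>K. \<forall>s\<in>{u..v}. \<bar>?h s\<bar> \<le> K)"
    proof (rule exI[of _ "min (x - a) (b - x)"], intro conjI allI impI)
      fix u v assume uv: "u \<le> x \<and> x \<le> v \<and> v - u < min (x - a) (b - x)"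
      have "\<bar>?h s\<bar> \<le> \<bar>?h x\<bar> + \<bar>l\<bar> + 1" if "s \<in> {u..v}" for s
        using that uv by (intro near) auto
      then show "\<exists>K. \<forall>s\<in>{u..v}. \<bar>?h s\<bar> \<le> K" by blast
    qed (use a b in auto)
  qed
  then obtain K where "\<forall>s\<in>{0..T}. \<bar>?h s\<bar> \<le> K" by blast
  then have "\<bar>?h (max 0 (min T s))\<bar> \<le> K" for s
    using \<open>T > 0\<close> by simp
  then have "\<bar>?h s\<bar> \<le> K" for s
    using \<open>T > 0\<close> by (simp add: clip_def)
  with left right show ?thesis unfolding cadlag_bounded_def by blast
qed

lemma jump_clip:
  assumes f: "cadlag_on T f" and t: "t \<in> {0<..T}"
  shows "jump (clip T f) t = jump f t"
proof -
  obtain l where l: "(f \<longlongrightarrow> l) (at_left t)" using f t unfolding cadlag_on_def by blast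
  moreover have "\<forall>\<^sub>F s in at_left t. f s = clip T f s"
    by (intro eventually_at_leftI[of 0]) (use t in auto)
  ultimately have "(clip T f \<longlongrightarrow> l) (at_left t)" by (rule Lim_transform_eventually)
  from jump_eqI[OF l] jump_eqI[OF this] show ?thesis using t by simp
qed

lemma bracket_clip:
  assumes "\<epsilon> \<ge> 0" "t \<in> {0..T}"
  shows "bracket (clip T f) (clip T g) \<epsilon> t = bracket f g \<epsilon> t"
  using assms by (intro bracket_cong) auto

text \<open>
  The limit \<open>B\<close> is bounded because it is cadlag; this is all that the bracket of \<open>(g, g)\<close> has to provide.
\<close>
lemma pathwise_pure_jump_covariation:
  assumes "T > 0" and e: "filterlim e (at_right 0) F" and "F \<noteq> bot"
    and f: "cadlag_on T f" and g: "cadlag_on T g" and A: "cadlag_on T A" and B: "cadlag_on T B"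
    and ffA: "uniform_limit {0..T} (\<lambda>n t. bracket f f (e n) t) A F"
    and ggB: "uniform_limit {0..T} (\<lambda>n t. bracket g g (e n) t) B F"
    and pure: "\<And>t. t \<in> {0..T} \<Longrightarrow> continuous_component A t = 0"
  shows "(\<lambda>s. \<bar>jump f s * jump g s\<bar>) summable_on {0<..T}"
    and "uniform_limit {0..T} (\<lambda>n t. bracket f g (e n) t)
      (\<lambda>t. \<Sum>\<^sub>\<infinity>s\<in>{0<..t}. jump f s * jump g s) F"
proof -
  let ?f = "clip T f" and ?g = "clip T g"
  have f': "cadlag_bounded ?f" and g': "cadlag_bounded ?g"
    using cadlag_bounded_clip \<open>T > 0\<close> f g by blast+
  have e0: "\<forall>\<^sub>F n in F. \<forall>t\<in>{0..T}. bracket (clip T x) (clip T y) (e n) t = bracket x y (e n) t" for x y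
  proof -
    have "\<forall>\<^sub>F n in F. e n \<ge> 0"
      using e by (auto simp: filterlim_at elim: eventually_mono)
    then show ?thesis by eventually_elim (simp add: bracket_clip)
  qed
  have ffA': "uniform_limit {0..T} (\<lambda>n t. bracket ?f ?f (e n) t) A F"
    using uniform_limit_cong[OF e0[of f f], of A A] ffA by simp
  have ggB': "uniform_limit {0..T} (\<lambda>n t. bracket ?g ?g (e n) t) B F"
    using uniform_limit_cong[OF e0[of g g], of B B] ggB by simp
  have pj: "((\<lambda>s. (jump ?f s)\<^sup>2) has_sum A t) {0<..t}" if "t \<in> {0..T}" for t
    by (rule pure_jump_quadratic_variation[OF f' e \<open>F \<noteq> bot\<close> ffA' _ that pure[OF that]])
      (use A in \<open>auto simp: cadlag_on_def\<close>)
  obtain K where K: "\<And>t. \<bar>clip T B t\<bar> \<le> K"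
    using cadlag_bounded_clip[OF B \<open>T > 0\<close>] by (auto simp: cadlag_bounded_def)
  have BK: "B t \<le> K" if "t \<in> {0..T}" for t
    using K[of t] that by (simp add: abs_le_iff)
  have jj: "jump ?f s * jump ?g s = jump f s * jump g s" if "s \<in> {0<..T}" for s
    using jump_clip[OF f that] jump_clip[OF g that] by simp
  note lim = pure_jump_bracket_limit[OF f' g' less_imp_le[OF \<open>T > 0\<close>] e \<open>F \<noteq> bot\<close> ffA' ggB' pj BK]
  show "(\<lambda>s. \<bar>jump f s * jump g s\<bar>) summable_on {0<..T}"
  proof (rule summable_on_cong[THEN iffD1, OF _ lim(1)])
    fix s assume "s \<in> {0<..T}"
    from jj[OF this] show "\<bar>jump ?f s * jump ?g s\<bar> = \<bar>jump f s * jump g s\<bar>" by (rule arg_cong)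
  qed
  have sums: "(\<Sum>\<^sub>\<infinity>s\<in>{0<..t}. jump ?f s * jump ?g s) = (\<Sum>\<^sub>\<infinity>s\<in>{0<..t}. jump f s * jump g s)"
    if "t \<in> {0..T}" for t
    using that by (intro infsum_cong jj) auto
  show "uniform_limit {0..T} (\<lambda>n t. bracket f g (e n) t)
      (\<lambda>t. \<Sum>\<^sub>\<infinity>s\<in>{0<..t}. jump f s * jump g s) F"
    by (rule uniform_limit_cong[OF e0[of f g] sums, THEN iffD1, OF _ lim(2)])
qed

text \<open>
  Dominated convergence: as \<open>u\<close> decreases to \<open>t\<close>, the time \<open>min (s + \<epsilon>) u\<close> is either constant near \<open>t\<close> or decreases
  to \<open>t\<close>.
\<close>
lemma bracket_right_continuous:
  assumes f: "cadlag_bounded f" and g: "cadlag_bounded g" and "\<epsilon> > 0"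
  shows "((\<lambda>t. bracket f g \<epsilon> t) \<longlongrightarrow> bracket f g \<epsilon> t) (at_right t)"
proof -
  note [measurable] = cadlag_bounded_measurable[OF f] cadlag_bounded_measurable[OF g]
  obtain K L where K: "\<And>t. \<bar>f t\<bar> \<le> K" and L: "\<And>t. \<bar>g t\<bar> \<le> L"
    using f g by (auto simp: cadlag_bounded_def)
  define \<phi> where "\<phi> u s = indicator {0..u} s * ((f (min (s + \<epsilon>) u) - f s) * (g (min (s + \<epsilon>) u) - g s))" for u s
  have br: "bracket f g \<epsilon> u = 1 / \<epsilon> * (LBINT s. \<phi> u s)" for u
    by (simp add: bracket_def \<phi>_def set_lebesgue_integral_def)
  have rl: "((\<lambda>u. k (min (s + \<epsilon>) u)) \<longlongrightarrow> k (min (s + \<epsilon>) t)) (at_right t)" if "cadlag_bounded k" for k s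
  proof (cases "t < s + \<epsilon>")
    case True
    have "\<forall>\<^sub>F u in at_right t. k u = k (min (s + \<epsilon>) u)"
      by (rule eventually_at_rightI[of t "s + \<epsilon>"]) (use True in auto)
    with cadlag_boundedD(1)[OF that, of t] show ?thesis
      using True Lim_transform_eventually by fastforce
  next
    case False
    have "\<forall>\<^sub>F u in at_right t. k (min (s + \<epsilon>) u) = k (min (s + \<epsilon>) t)"
      by (rule eventually_at_rightI[of t "t + 1"]) (use False in \<open>auto simp: min_def\<close>)
    then show ?thesis by (rule tendsto_eventually)
  qed
  have ind: "((\<lambda>u. indicator {0..u} s :: real) \<longlongrightarrow> indicator {0..t} s) (at_right t)" for s
  proof (cases "0 \<le> s")
    case True
    have "((\<lambda>u. of_bool (s \<le> u) :: real) \<longlongrightarrow> of_bool (s \<le> t)) (at_right t)"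
      by (rule cadlag_boundedD(1)[OF cadlag_bounded_step])
    then show ?thesis using True by (simp add: indicator_def of_bool_def)
  qed simp
  have "((\<lambda>u. LBINT s. \<phi> u s) \<longlongrightarrow> (LBINT s. \<phi> t s)) (at_right t)"
  proof (rule tendsto_at_right_sequentially[of t "t + 1"])
    fix u :: "nat \<Rightarrow> real"
    assume u: "\<And>n. t < u n" "\<And>n. u n < t + 1" "u \<longlonglongrightarrow> t"
    have ut: "filterlim u (at_right t) sequentially"
      unfolding filterlim_at using u less_imp_neq[OF u(1), symmetric] by (auto intro!: always_eventually)
    show "(\<lambda>n. LBINT s. \<phi> (u n) s) \<longlonglongrightarrow> (LBINT s. \<phi> t s)"
    proof (rule integral_dominated_convergence[where w = "\<lambda>s. indicator {0..t+1} s * ((2 * K) * (2 * L))"])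
      show "integrable lborel (\<lambda>s. indicator {0..t+1} s * ((2 * K) * (2 * L)))"
        by (intro integrable_mult_left integrable_real_indicator) (auto simp: emeasure_lborel_Icc_eq)
      show "AE s in lborel. (\<lambda>n. \<phi> (u n) s) \<longlonglongrightarrow> \<phi> t s"
        unfolding \<phi>_def
        by (intro AE_I2 tendsto_intros filterlim_compose[OF rl ut] filterlim_compose[OF ind ut] f g)
      show "AE s in lborel. norm (\<phi> (u n) s) \<le> indicator {0..t+1} s * ((2 * K) * (2 * L))" for n
      proof (rule AE_I2)
        fix s
        show "norm (\<phi> (u n) s) \<le> indicator {0..t+1} s * ((2 * K) * (2 * L))"
          using increment_product_bound[OF K K L L, of "min (s + \<epsilon>) (u n)" s "min (s + \<epsilon>) (u n)" s] u(2)[of n]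
          by (cases "s \<in> {0..u n}") (auto simp: \<phi>_def indicator_def)
      qed
    qed (simp_all add: \<phi>_def)
  qed simp
  then show ?thesis unfolding br by (rule tendsto_mult_left)
qed

section \<open>Measurability and u.c.p. convergence\<close>
lemma bracket_measurable:
  fixes Y Z :: "real \<Rightarrow> 'a \<Rightarrow> real"
  assumes Y: "\<And>t. Y t \<in> borel_measurable M" "\<And>\<omega>. \<omega> \<in> space M \<Longrightarrow> cadlag_bounded (\<lambda>t. Y t \<omega>)"
    and Z: "\<And>t. Z t \<in> borel_measurable M" "\<And>\<omega>. \<omega> \<in> space M \<Longrightarrow> cadlag_bounded (\<lambda>t. Z t \<omega>)"
  shows "(\<lambda>\<omega>. bracket (\<lambda>t. Y t \<omega>) (\<lambda>t. Z t \<omega>) \<epsilon> t) \<in> borel_measurable M"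
proof -
  have "(\<lambda>(s, \<omega>). Y s \<omega>) \<in> borel_measurable (borel \<Otimes>\<^sub>M M)"
    by (intro right_continuous_jointly_measurable Y cadlag_boundedD(1)[OF Y(2)])
  note Y' = measurable_compose[OF _ this, unfolded split_beta]
  have "(\<lambda>(s, \<omega>). Z s \<omega>) \<in> borel_measurable (borel \<Otimes>\<^sub>M M)"
    by (intro right_continuous_jointly_measurable Z cadlag_boundedD(1)[OF Z(2)])
  note Z' = measurable_compose[OF _ this, unfolded split_beta]
  have [measurable]: "(\<lambda>p. Y (snd p) (fst p)) \<in> borel_measurable (M \<Otimes>\<^sub>M lborel)"
    "(\<lambda>p. Y (min (snd p + \<epsilon>) t) (fst p)) \<in> borel_measurable (M \<Otimes>\<^sub>M lborel)"
    using Y'[of "\<lambda>p. (snd p, fst p)" "M \<Otimes>\<^sub>M lborel"]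
      Y'[of "\<lambda>p. (min (snd p + \<epsilon>) t, fst p)" "M \<Otimes>\<^sub>M lborel"] by simp_all
  have [measurable]: "(\<lambda>p. Z (snd p) (fst p)) \<in> borel_measurable (M \<Otimes>\<^sub>M lborel)"
    "(\<lambda>p. Z (min (snd p + \<epsilon>) t) (fst p)) \<in> borel_measurable (M \<Otimes>\<^sub>M lborel)"
    using Z'[of "\<lambda>p. (snd p, fst p)" "M \<Otimes>\<^sub>M lborel"]
      Z'[of "\<lambda>p. (min (snd p + \<epsilon>) t, fst p)" "M \<Otimes>\<^sub>M lborel"] by simp_all
  show ?thesis
    unfolding bracket_def set_lebesgue_integral_def
    by (intro borel_measurable_times borel_measurable_const lborel.borel_measurable_lebesgue_integral)
      (simp add: split_beta)
qed

text \<open>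
  A version all of whose paths are cadlag makes the brackets measurable in \<open>\<omega>\<close>; almost surely they
  coincide with those of the original process, for all times in \<open>{0..T}\<close> and all \<open>\<epsilon> > 0\<close> at once.
\<close>
lemma cadlag_process_regular_version:
  assumes Y: "cadlag_process M T Y" and "T > 0"
  obtains Y' where "\<And>t. Y' t \<in> borel_measurable M"
    and "\<And>\<omega>. \<omega> \<in> space M \<Longrightarrow> cadlag_bounded (\<lambda>t. Y' t \<omega>)"
    and "AE \<omega> in M. \<forall>t\<in>{0..T}. Y' t \<omega> = Y t \<omega>"
proof -
  have "AE \<omega> in M. cadlag_on T (\<lambda>t. Y t \<omega>)" using Y by (simp add: cadlag_process_def)
  then obtain N where N: "{\<omega>\<in>space M. \<not> cadlag_on T (\<lambda>t. Y t \<omega>)} \<subseteq> N" "N \<in> sets M" "emeasure M N = 0"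
    by (rule AE_E)
  define Y' where "Y' t \<omega> = (if \<omega> \<in> N then 0 else clip T (\<lambda>r. Y r \<omega>) t)" for t \<omega>
  show thesis
  proof
    fix t
    have "max 0 (min T t) \<in> {0..T}" using \<open>T > 0\<close> by auto
    then have "Y (max 0 (min T t)) \<in> borel_measurable M" using Y by (simp add: cadlag_process_def)
    then show "Y' t \<in> borel_measurable M"
      unfolding Y'_def clip_def using N(2) by (intro measurable_If_set) auto
  next
    fix \<omega> assume "\<omega> \<in> space M"
    then show "cadlag_bounded (\<lambda>t. Y' t \<omega>)"
      using N(1) cadlag_bounded_clip[OF _ \<open>T > 0\<close>, of "\<lambda>t. Y t \<omega>"]
      by (cases "\<omega> \<in> N") (auto simp: Y'_def cadlag_bounded_def)
  next
    have "AE \<omega> in M. \<omega> \<notin> N" using N by (intro AE_not_in null_setsI)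
    then show "AE \<omega> in M. \<forall>t\<in>{0..T}. Y' t \<omega> = Y t \<omega>"
      by eventually_elim (simp add: Y'_def)
  qed
qed

text \<open>
  Any property \<open>P\<close> that holds for arbitrarily small \<open>\<epsilon>\<close> may be imposed on the sequence. This makes it
  possible to refute that an outer measure stays away from \<open>0\<close>. Two u.c.p. limits are treated at once so
  that they share the sequence.
\<close>
lemma ucp_limit_AE_sequence:
  assumes X: "ucp_limit M T X C (at_right 0)" and X': "ucp_limit M T X' C' (at_right 0)"
    and P: "\<exists>\<^sub>F \<epsilon> in at_right (0::real). P \<epsilon>"
  obtains e :: "nat \<Rightarrow> real" where "\<And>n. P (e n)" and "\<And>n. e n > 0" and "filterlim e (at_right 0) sequentially"
    and "AE \<omega> in M. uniform_limit {0..T} (\<lambda>n t. X (e n) t \<omega>) (\<lambda>t. C t \<omega>) sequentially"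
    and "AE \<omega> in M. uniform_limit {0..T} (\<lambda>n t. X' (e n) t \<omega>) (\<lambda>t. C' t \<omega>) sequentially"
proof -
  define bad where "bad X C \<delta> \<epsilon> = {\<omega>\<in>space M. \<exists>t\<in>{0..T}. \<bar>X \<epsilon> t \<omega> - C t \<omega>\<bar> > \<delta>}"
    for X :: "real \<Rightarrow> real \<Rightarrow> 'a \<Rightarrow> real" and C :: "real \<Rightarrow> 'a \<Rightarrow> real" and \<delta> \<epsilon> :: real
  have small: "\<forall>\<^sub>F \<epsilon> in at_right 0. outer_measure_of M (bad X C (1 / real (Suc n)) \<epsilon>) < ennreal ((1/2) ^ n)"
    if "ucp_limit M T X C (at_right 0)" for X C n
    using that unfolding ucp_limit_def bad_def by (intro order_tendstoD(2)[where y = 0]) auto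
  have "\<exists>\<epsilon>. P \<epsilon> \<and> \<epsilon> \<in> {0<..<1 / real (Suc n)} \<and>
      outer_measure_of M (bad X C (1 / real (Suc n)) \<epsilon>) < ennreal ((1/2) ^ n) \<and>
      outer_measure_of M (bad X' C' (1 / real (Suc n)) \<epsilon>) < ennreal ((1/2) ^ n)" for n
  proof -
    have "\<forall>\<^sub>F \<epsilon> in at_right 0. \<epsilon> \<in> {0<..<1 / real (Suc n)}"
      by (intro eventually_at_right_real) simp
    then have "\<forall>\<^sub>F \<epsilon> in at_right 0. \<epsilon> \<in> {0<..<1 / real (Suc n)} \<and>
      outer_measure_of M (bad X C (1 / real (Suc n)) \<epsilon>) < ennreal ((1/2) ^ n) \<and>
      outer_measure_of M (bad X' C' (1 / real (Suc n)) \<epsilon>) < ennreal ((1/2) ^ n)"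
      by (intro eventually_conj small X X')
    from frequently_ex[OF frequently_eventually_conj[OF P this]] show ?thesis by blast
  qed
  then obtain e where e: "\<And>n. P (e n)" "\<And>n. e n \<in> {0<..<1 / real (Suc n)}"
    "\<And>n. outer_measure_of M (bad X C (1 / real (Suc n)) (e n)) < ennreal ((1/2) ^ n)"
    "\<And>n. outer_measure_of M (bad X' C' (1 / real (Suc n)) (e n)) < ennreal ((1/2) ^ n)"
    by metis
  have AE: "AE \<omega> in M. uniform_limit {0..T} (\<lambda>n t. X (e n) t \<omega>) (\<lambda>t. C t \<omega>) sequentially"
    if small: "\<And>n. outer_measure_of M (bad X C (1 / real (Suc n)) (e n)) < ennreal ((1/2) ^ n)" for X C
  proof -
    \<comment> \<open>Borel-Cantelli needs measurable events, hence the covers of the same outer measure.\<close>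
    have "\<exists>E\<in>sets M. bad X C (1 / real (Suc n)) (e n) \<subseteq> E \<and>
        outer_measure_of M (bad X C (1 / real (Suc n)) (e n)) = emeasure M E" for n
      by (rule outer_measure_of_attain) (auto simp: bad_def)
    then obtain E where E: "\<And>n. E n \<in> sets M" "\<And>n. bad X C (1 / real (Suc n)) (e n) \<subseteq> E n"
      "\<And>n. emeasure M (E n) < ennreal ((1/2) ^ n)"
      using small by metis
    have "AE \<omega> in M. \<forall>\<^sub>F n in sequentially. \<omega> \<in> space M - E n"
    proof (rule borel_cantelli_AE1)
      show "emeasure M (E n) < \<infinity>" for n
        using order.strict_trans[OF E(3) ennreal_less_top] by simp
      have "measure M (E n) \<le> (1/2) ^ n" for n
        using E(3)[of n] by (simp add: measure_def enn2real_leI)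
      then have le: "norm (measure M (E n)) \<le> (1/2) ^ n" for n by simp
      have "summable (\<lambda>n. (1/2 :: real) ^ n)" by (rule summable_geometric) simp
      then show "summable (\<lambda>n. measure M (E n))"
        by (rule summable_comparison_test') (rule le)
    qed fact
    then show ?thesis
    proof eventually_elim
      case (elim \<omega>)
      show ?case
      proof (rule uniform_limitI)
        fix r :: real assume "r > 0"
        then have "\<forall>\<^sub>F n in sequentially. 1 / real (Suc n) < r"
          using order_tendstoD(2)[OF LIMSEQ_inverse_real_of_nat, of r] by (simp add: inverse_eq_divide)
        with elim show "\<forall>\<^sub>F n in sequentially. \<forall>t\<in>{0..T}. dist (X (e n) t \<omega>) (C t \<omega>) < r"
        proof eventually_elim
          case (elim n)
          then have "\<omega> \<notin> bad X C (1 / real (Suc n)) (e n)" and "\<omega> \<in> space M" using E(2)[of n] by auto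
          then have "\<bar>X (e n) t \<omega> - C t \<omega>\<bar> \<le> 1 / real (Suc n)" if "t \<in> {0..T}" for t
            using that unfolding bad_def by (auto simp: not_less)
          then show ?case using elim(2) unfolding dist_real_def by (meson le_less_trans)
        qed
      qed
    qed
  qed
  have "e \<longlonglongrightarrow> 0"
  proof (rule tendsto_sandwich)
    show "\<forall>\<^sub>F n in sequentially. 0 \<le> e n" "\<forall>\<^sub>F n in sequentially. e n \<le> inverse (real (Suc n))"
      using e(2) by (auto intro!: always_eventually simp: inverse_eq_divide less_imp_le)
    show "(\<lambda>n. inverse (real (Suc n))) \<longlonglongrightarrow> 0" by (rule LIMSEQ_inverse_real_of_nat)
  qed simp
  moreover have pos: "e n > 0" for n using e(2)[of n] by simp
  ultimately have "filterlim e (at_right 0) sequentially"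
    unfolding filterlim_at using less_imp_neq[OF pos, symmetric] by (auto intro!: always_eventually)
  from that[OF e(1) pos this AE[of X C, OF e(3)] AE[of X' C', OF e(4)]] show thesis .
qed

lemma ucp_limit_unique:
  assumes "ucp_limit M T X C (at_right (0::real))" "ucp_limit M T X C' (at_right 0)"
  shows "AE \<omega> in M. \<forall>t\<in>{0..T}. C t \<omega> = C' t \<omega>"
proof -
  have "\<exists>\<^sub>F \<epsilon> in at_right (0::real). True" by simp
  then obtain e :: "nat \<Rightarrow> real" where
    "AE \<omega> in M. uniform_limit {0..T} (\<lambda>n t. X (e n) t \<omega>) (\<lambda>t. C t \<omega>) sequentially"
    "AE \<omega> in M. uniform_limit {0..T} (\<lambda>n t. X (e n) t \<omega>) (\<lambda>t. C' t \<omega>) sequentially"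
    by (rule ucp_limit_AE_sequence[OF assms]) (rule that)
  then show ?thesis
  proof eventually_elim
    case (elim \<omega>)
    then show ?case by (meson LIMSEQ_unique tendsto_uniform_limitI)
  qed
qed

text \<open>
  Almost sure convergence does not imply that outer measures tend to \<open>0\<close> when the events are not
  measurable. By right-continuity, outside a null set it suffices to test a countable set of times
  that is dense in \<open>{0..T}\<close> and contains \<open>T\<close>, where no approximation from the right is possible; the
  resulting events are measurable, and dominated convergence applies to them.
\<close>
lemma AE_uniform_limit_imp_outer_measure_limit:
  fixes X X' :: "nat \<Rightarrow> real \<Rightarrow> 'a \<Rightarrow> real"
  assumes "prob_space M" and "T \<ge> 0" and "\<delta> > 0"
    and X' [measurable]: "\<And>n t. X' n t \<in> borel_measurable M"
    and C: "\<And>t. t \<in> {0..T} \<Longrightarrow> C t \<in> borel_measurable M"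
    and rX: "\<And>n t \<omega>. \<omega> \<in> space M \<Longrightarrow> ((\<lambda>s. X' n s \<omega>) \<longlongrightarrow> X' n t \<omega>) (at_right t)"
    and rC: "AE \<omega> in M. cadlag_on T (\<lambda>t. C t \<omega>)"
    and eq: "AE \<omega> in M. \<forall>n. \<forall>t\<in>{0..T}. X n t \<omega> = X' n t \<omega>"
    and lim: "AE \<omega> in M. uniform_limit {0..T} (\<lambda>n t. X n t \<omega>) (\<lambda>t. C t \<omega>) sequentially"
  shows "(\<lambda>n. outer_measure_of M {\<omega>\<in>space M. \<exists>t\<in>{0..T}. \<bar>X n t \<omega> - C t \<omega>\<bar> > \<delta>}) \<longlonglongrightarrow> 0"
proof -
  interpret prob_space M by fact
  define Q where "Q = insert T ({0..T} \<inter> \<rat>)"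
  have Q: "countable Q" "Q \<subseteq> {0..T}"
    using \<open>T \<ge> 0\<close> countable_rat by (auto simp: Q_def)
  define E where "E n = (\<Union>t\<in>Q. {\<omega>\<in>space M. \<bar>X' n t \<omega> - C t \<omega>\<bar> > \<delta>})" for n
  have E [measurable]: "E n \<in> sets M" for n
    unfolding E_def
  proof (rule sets.countable_UN'[OF Q(1)], rule image_subsetI)
    fix t assume "t \<in> Q"
    with Q C have [measurable]: "C t \<in> borel_measurable M" by auto
    show "{\<omega> \<in> space M. \<delta> < \<bar>X' n t \<omega> - C t \<omega>\<bar>} \<in> sets M" by measurable
  qed
  have outer: "outer_measure_of M {\<omega>\<in>space M. \<exists>t\<in>{0..T}. \<bar>X n t \<omega> - C t \<omega>\<bar> > \<delta>} \<le> ennreal (prob (E n))" for n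
  proof -
    from rC eq have "AE \<omega> in M. cadlag_on T (\<lambda>t. C t \<omega>) \<and> (\<forall>t\<in>{0..T}. X n t \<omega> = X' n t \<omega>)"
      by eventually_elim simp
    then obtain N where N: "N \<in> sets M" "emeasure M N = 0"
      "{\<omega>\<in>space M. \<not> (cadlag_on T (\<lambda>t. C t \<omega>) \<and> (\<forall>t\<in>{0..T}. X n t \<omega> = X' n t \<omega>))} \<subseteq> N"
      by (rule AE_E)
    have "{\<omega>\<in>space M. \<exists>t\<in>{0..T}. \<bar>X n t \<omega> - C t \<omega>\<bar> > \<delta>} \<subseteq> E n \<union> N"
    proof
      fix \<omega> assume "\<omega> \<in> {\<omega>\<in>space M. \<exists>t\<in>{0..T}. \<bar>X n t \<omega> - C t \<omega>\<bar> > \<delta>}"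
      then obtain t where t: "\<omega> \<in> space M" "t \<in> {0..T}" "\<bar>X n t \<omega> - C t \<omega>\<bar> > \<delta>" by auto
      show "\<omega> \<in> E n \<union> N"
      proof (rule ccontr)
        assume notin: "\<omega> \<notin> E n \<union> N"
        with t N(3) have c: "cadlag_on T (\<lambda>t. C t \<omega>)" and x: "X n t \<omega> = X' n t \<omega>"
          by blast+
        with notin t have "t \<noteq> T" by (auto simp: E_def Q_def)
        with t have "t < T" by simp
        have "((\<lambda>s. \<bar>X' n s \<omega> - C s \<omega>\<bar>) \<longlongrightarrow> \<bar>X' n t \<omega> - C t \<omega>\<bar>) (at_right t)"
          using c t \<open>t < T\<close> by (intro tendsto_intros rX) (auto simp: cadlag_on_def)
        then have "\<forall>\<^sub>F s in at_right t. \<delta> < \<bar>X' n s \<omega> - C s \<omega>\<bar>"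
          using t(3) unfolding x by (rule order_tendstoD)
        then obtain b where b: "b > t" "\<And>s. t < s \<Longrightarrow> s < b \<Longrightarrow> \<delta> < \<bar>X' n s \<omega> - C s \<omega>\<bar>"
          by (auto simp: eventually_at_right_field)
        obtain q where "q \<in> \<rat>" "t < q" "q < min b T"
          using Rats_dense_in_real[of t "min b T"] b \<open>t < T\<close> by auto
        then have "q \<in> Q" "\<delta> < \<bar>X' n q \<omega> - C q \<omega>\<bar>" using t b by (auto simp: Q_def)
        then show False using t notin by (auto simp: E_def)
      qed
    qed
    then have "outer_measure_of M {\<omega>\<in>space M. \<exists>t\<in>{0..T}. \<bar>X n t \<omega> - C t \<omega>\<bar> > \<delta>} \<le> outer_measure_of M (E n \<union> N)"
      by (rule outer_measure_of_mono)
    also have "\<dots> = ennreal (prob (E n))"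
      using N E by (subst outer_measure_of_eq) (simp_all add: emeasure_Un_null_set null_setsI flip: emeasure_eq_measure)
    finally show ?thesis .
  qed
  have "(\<lambda>n. \<integral>\<omega>. indicator (E n) \<omega> \<partial>M) \<longlonglongrightarrow> (\<integral>\<omega>. 0 \<partial>M :: real)"
  proof (rule integral_dominated_convergence[where w = "\<lambda>_. 1"])
    show "AE \<omega> in M. (\<lambda>n. indicator (E n) \<omega> :: real) \<longlonglongrightarrow> 0"
      using lim eq
    proof eventually_elim
      case (elim \<omega>)
      have "\<forall>\<^sub>F n in sequentially. \<forall>t\<in>{0..T}. dist (X n t \<omega>) (C t \<omega>) < \<delta>"
        using elim(1) \<open>\<delta> > 0\<close> by (rule uniform_limitD)
      then have "\<forall>\<^sub>F n in sequentially. indicator (E n) \<omega> = (0::real)"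
      proof eventually_elim
        case (elim n)
        have "\<not> \<bar>X' n t \<omega> - C t \<omega>\<bar> > \<delta>" if "t \<in> Q" for t
        proof -
          have "t \<in> {0..T}" using Q that by auto
          with elim \<open>\<forall>n. \<forall>t\<in>{0..T}. X n t \<omega> = X' n t \<omega>\<close> have "dist (X' n t \<omega>) (C t \<omega>) < \<delta>" by metis
          then show ?thesis by (simp add: dist_real_def)
        qed
        then show ?case by (auto simp: E_def indicator_def)
      qed
      then show ?case by (rule tendsto_eventually)
    qed
  qed (auto simp: indicator_def)
  then have "(\<lambda>n. prob (E n)) \<longlonglongrightarrow> 0" by simp
  then have "(\<lambda>n. ennreal (prob (E n))) \<longlonglongrightarrow> ennreal 0" by (rule tendsto_ennrealI)
  then have p: "(\<lambda>n. ennreal (prob (E n))) \<longlonglongrightarrow> 0" by simp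
  show ?thesis
    by (rule tendsto_sandwich[OF _ _ tendsto_const p]) (auto intro!: always_eventually outer)
qed

lemma cadlag_on_cong:
  assumes "\<And>t. t \<in> {0..T} \<Longrightarrow> f t = g t"
  shows "cadlag_on T f \<longleftrightarrow> cadlag_on T g"
proof -
  have *: "cadlag_on T g" if f: "cadlag_on T f" and eq: "\<And>t. t \<in> {0..T} \<Longrightarrow> f t = g t" for f g
    unfolding cadlag_on_def
  proof (intro conjI ballI)
    fix t assume t: "t \<in> {0..<T}"
    have ev: "\<forall>\<^sub>F s in at_right t. f s = g s"
      by (rule eventually_at_rightI[of t T]) (use t eq in auto)
    have lim: "(f \<longlongrightarrow> f t) (at_right t)" using f t by (simp add: cadlag_on_def)
    show "(g \<longlongrightarrow> g t) (at_right t)" using Lim_transform_eventually[OF lim ev] eq[of t] t by simp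
  next
    fix t assume t: "t \<in> {0<..T}"
    have "\<forall>\<^sub>F s in at_left t. f s = g s"
      by (rule eventually_at_leftI[of 0]) (use t eq in auto)
    moreover obtain l where "(f \<longlongrightarrow> l) (at_left t)" using f t unfolding cadlag_on_def by blast
    ultimately show "\<exists>l. (g \<longlongrightarrow> l) (at_left t)" using Lim_transform_eventually by blast
  qed
  show ?thesis using *[of f g] *[of g f] assms by auto
qed

lemma approx_covariation_eq_bracket:
  "approx_covariation Y Z \<epsilon> t \<omega> = bracket (\<lambda>r. Y r \<omega>) (\<lambda>r. Z r \<omega>) \<epsilon> t"
  by (simp add: approx_covariation_def bracket_def)

lemma is_covariation_covariation:
  "covariation_exists M T Y Z \<Longrightarrow> is_covariation M T Y Z (covariation M T Y Z)"
  unfolding covariation_exists_def covariation_def by (rule someI_ex[where P = "is_covariation M T Y Z"])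

section \<open>The covariation with a pure jump process\<close>
theorem lemma2p6:
  fixes M :: "'a measure" and T :: real and Y Z :: "real \<Rightarrow> 'a \<Rightarrow> real"
  assumes "prob_space M"
    and "T > 0"
    and "cadlag_process M T Y"
    and "cadlag_process M T Z"
    and "finite_quadratic_variation M T Y"
    and "finite_quadratic_variation M T Z"
    and "AE \<omega> in M. \<forall>t\<in>{0..T}. continuous_component (\<lambda>s. covariation M T Y Y s \<omega>) t = 0"
  shows "covariation_exists M T Y Z \<and>
    (AE \<omega> in M. \<forall>t\<in>{0..T}.
      ((\<lambda>s. jump (\<lambda>r. Y r \<omega>) s * jump (\<lambda>r. Z r \<omega>) s) has_sum covariation M T Y Z t \<omega>) {0<..t})"
proof -
  define A where "A = covariation M T Y Y"
  define B where "B = covariation M T Z Z"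
  have A: "is_covariation M T Y Y A" and B: "is_covariation M T Z Z B"
    using assms(5,6) unfolding finite_quadratic_variation_def A_def B_def
    by (auto intro: is_covariation_covariation)
  note ucpA = A[unfolded is_covariation_def, THEN conjunct2]
  note ucpB = B[unfolded is_covariation_def, THEN conjunct2]
  define S where "S t \<omega> = (\<Sum>\<^sub>\<infinity>s\<in>{0<..t}. jump (\<lambda>r. Y r \<omega>) s * jump (\<lambda>r. Z r \<omega>) s)" for t \<omega>
  have paths: "AE \<omega> in M. cadlag_on T (\<lambda>t. Y t \<omega>) \<and> cadlag_on T (\<lambda>t. Z t \<omega>)
      \<and> cadlag_on T (\<lambda>t. A t \<omega>) \<and> cadlag_on T (\<lambda>t. B t \<omega>)
      \<and> (\<forall>t\<in>{0..T}. continuous_component (\<lambda>s. A s \<omega>) t = 0)"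
    using assms(3,4,7) A B unfolding is_covariation_def cadlag_process_def A_def by auto
  \<comment> \<open>The limit \<open>S\<close> is the same for every such sequence; this is what turns convergence along sequences
    into convergence as \<open>\<epsilon>\<close> tends to \<open>0\<close>.\<close>
  have sequence: "\<exists>e. (\<forall>n. P (e n) \<and> e n > 0) \<and> (AE \<omega> in M.
      (\<lambda>s. \<bar>jump (\<lambda>r. Y r \<omega>) s * jump (\<lambda>r. Z r \<omega>) s\<bar>) summable_on {0<..T} \<and>
      uniform_limit {0..T} (\<lambda>n t. approx_covariation Y Z (e n) t \<omega>) (\<lambda>t. S t \<omega>) sequentially)"
    if P: "\<exists>\<^sub>F \<epsilon> in at_right 0. P \<epsilon>" for P
  proof -
    obtain e :: "nat \<Rightarrow> real" where e: "\<And>n. P (e n)" "\<And>n. e n > 0" "filterlim e (at_right 0) sequentially"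
      "AE \<omega> in M. uniform_limit {0..T} (\<lambda>n t. approx_covariation Y Y (e n) t \<omega>) (\<lambda>t. A t \<omega>) sequentially"
      "AE \<omega> in M. uniform_limit {0..T} (\<lambda>n t. approx_covariation Z Z (e n) t \<omega>) (\<lambda>t. B t \<omega>) sequentially"
      by (rule ucp_limit_AE_sequence[OF ucpA ucpB P]) (rule that)
    from paths e(4,5) have "AE \<omega> in M.
      (\<lambda>s. \<bar>jump (\<lambda>r. Y r \<omega>) s * jump (\<lambda>r. Z r \<omega>) s\<bar>) summable_on {0<..T} \<and>
      uniform_limit {0..T} (\<lambda>n t. approx_covariation Y Z (e n) t \<omega>) (\<lambda>t. S t \<omega>) sequentially"
    proof eventually_elim
      case (elim \<omega>)
      then show ?case
        unfolding approx_covariation_eq_bracket S_def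
        using pathwise_pure_jump_covariation[OF \<open>T > 0\<close> e(3) sequentially_bot] by blast
    qed
    with e show ?thesis by blast
  qed
  obtain Y' where Y': "\<And>t. Y' t \<in> borel_measurable M"
    "\<And>\<omega>. \<omega> \<in> space M \<Longrightarrow> cadlag_bounded (\<lambda>t. Y' t \<omega>)"
    and YY': "AE \<omega> in M. \<forall>t\<in>{0..T}. Y' t \<omega> = Y t \<omega>"
    using cadlag_process_regular_version[OF assms(3,2)] by blast
  obtain Z' where Z': "\<And>t. Z' t \<in> borel_measurable M"
    "\<And>\<omega>. \<omega> \<in> space M \<Longrightarrow> cadlag_bounded (\<lambda>t. Z' t \<omega>)"
    and ZZ': "AE \<omega> in M. \<forall>t\<in>{0..T}. Z' t \<omega> = Z t \<omega>"
    using cadlag_process_regular_version[OF assms(4,2)] by blast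
  define X' where "X' \<epsilon> t \<omega> = bracket (\<lambda>r. Y' r \<omega>) (\<lambda>r. Z' r \<omega>) \<epsilon> t" for \<epsilon> t \<omega>
  have X': "X' \<epsilon> t \<in> borel_measurable M" for \<epsilon> t
    unfolding X'_def by (rule bracket_measurable[OF Y' Z'])
  have XX': "AE \<omega> in M. \<forall>\<epsilon>>0. \<forall>t\<in>{0..T}. approx_covariation Y Z \<epsilon> t \<omega> = X' \<epsilon> t \<omega>"
    using YY' ZZ'
  proof eventually_elim
    case (elim \<omega>)
    then show ?case
      unfolding approx_covariation_eq_bracket X'_def by (auto intro!: bracket_cong)
  qed
  have "\<exists>\<^sub>F \<epsilon> in at_right (0::real). True" by simp
  from sequence[OF this] obtain e where e: "\<And>n. e n > 0"
    and lim: "AE \<omega> in M. (\<lambda>s. \<bar>jump (\<lambda>r. Y r \<omega>) s * jump (\<lambda>r. Z r \<omega>) s\<bar>) summable_on {0<..T} \<and>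
      uniform_limit {0..T} (\<lambda>n t. approx_covariation Y Z (e n) t \<omega>) (\<lambda>t. S t \<omega>) sequentially"
    by auto
  \<comment> \<open>\<open>M\<close> may be incomplete, so \<open>S\<close> itself need not be measurable. The limit of the brackets of the regular
    versions is, and it agrees with \<open>S\<close> almost surely.\<close>
  define C where "C t \<omega> = lim (\<lambda>n. X' (e n) t \<omega>)" for t \<omega>
  have C: "C t \<in> borel_measurable M" for t
    unfolding C_def by (rule borel_measurable_lim_metric) (rule X')
  have CS: "AE \<omega> in M. \<forall>t\<in>{0..T}. C t \<omega> = S t \<omega>"
    using lim XX'
  proof eventually_elim
    case (elim \<omega>)
    show ?case
    proof
      fix t assume t: "t \<in> {0..T}"
      have "(\<lambda>n. approx_covariation Y Z (e n) t \<omega>) \<longlonglongrightarrow> S t \<omega>"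
        using elim(1) t by (auto intro: tendsto_uniform_limitI)
      then have "(\<lambda>n. X' (e n) t \<omega>) \<longlonglongrightarrow> S t \<omega>" using elim(2) t e by simp
      then show "C t \<omega> = S t \<omega>" unfolding C_def by (rule limI)
    qed
  qed
  have cadlagC: "AE \<omega> in M. cadlag_on T (\<lambda>t. C t \<omega>)"
    using lim CS
  proof eventually_elim
    case (elim \<omega>)
    then have "cadlag_on T (\<lambda>t. S t \<omega>)" unfolding S_def by (intro cadlag_jump_sum) simp
    then show ?case using elim(2) cadlag_on_cong[of T "\<lambda>t. C t \<omega>" "\<lambda>t. S t \<omega>"] by simp
  qed
  have "ucp_limit M T (approx_covariation Y Z) C (at_right 0)"
    unfolding ucp_limit_def
  proof (intro allI impI order_tendstoI)
    fix \<delta> :: real and a :: ennreal assume "\<delta> > 0" "0 < a"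
    let ?p = "\<lambda>\<epsilon>. outer_measure_of M {\<omega>\<in>space M. \<exists>t\<in>{0..T}. \<bar>approx_covariation Y Z \<epsilon> t \<omega> - C t \<omega>\<bar> > \<delta>}"
    show "\<forall>\<^sub>F \<epsilon> in at_right 0. ?p \<epsilon> < a"
    proof (rule ccontr)
      assume "\<not> (\<forall>\<^sub>F \<epsilon> in at_right 0. ?p \<epsilon> < a)"
      then have "\<exists>\<^sub>F \<epsilon> in at_right 0. \<not> ?p \<epsilon> < a" by (simp add: not_eventually)
      from sequence[OF this] obtain d where d: "\<And>n. \<not> ?p (d n) < a" "\<And>n. d n > 0"
        and limd: "AE \<omega> in M. (\<lambda>s. \<bar>jump (\<lambda>r. Y r \<omega>) s * jump (\<lambda>r. Z r \<omega>) s\<bar>) summable_on {0<..T} \<and>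
          uniform_limit {0..T} (\<lambda>n t. approx_covariation Y Z (d n) t \<omega>) (\<lambda>t. S t \<omega>) sequentially"
        by auto
      have "(\<lambda>n. ?p (d n)) \<longlonglongrightarrow> 0"
      proof (rule AE_uniform_limit_imp_outer_measure_limit[where X' = "\<lambda>n. X' (d n)"])
        show "((\<lambda>s. X' (d n) s \<omega>) \<longlongrightarrow> X' (d n) t \<omega>) (at_right t)" if "\<omega> \<in> space M" for n t \<omega>
          unfolding X'_def by (rule bracket_right_continuous[OF Y'(2)[OF that] Z'(2)[OF that] d(2)])
        show "AE \<omega> in M. \<forall>n. \<forall>t\<in>{0..T}. approx_covariation Y Z (d n) t \<omega> = X' (d n) t \<omega>"
          using XX' by eventually_elim (simp add: d)
        show "AE \<omega> in M. uniform_limit {0..T} (\<lambda>n t. approx_covariation Y Z (d n) t \<omega>) (\<lambda>t. C t \<omega>) sequentially"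
          using limd CS
        proof eventually_elim
          case (elim \<omega>)
          then show ?case
            using uniform_limit_cong'[of "{0..T}" "\<lambda>n t. approx_covariation Y Z (d n) t \<omega>"
                "\<lambda>n t. approx_covariation Y Z (d n) t \<omega>" "\<lambda>t. C t \<omega>" "\<lambda>t. S t \<omega>"] by simp
        qed
      qed (use assms(1,2) \<open>\<delta> > 0\<close> X' C cadlagC in auto)
      from order_tendstoD(2)[OF this \<open>0 < a\<close>] show False
        using d(1) by (auto dest: eventually_happens)
    qed
  qed simp
  then have isC: "is_covariation M T Y Z C"
    unfolding is_covariation_def cadlag_process_def using C cadlagC by blast
  then have ex: "covariation_exists M T Y Z" unfolding covariation_exists_def by blast
  from is_covariation_covariation[OF this] isC
  have "AE \<omega> in M. \<forall>t\<in>{0..T}. covariation M T Y Z t \<omega> = C t \<omega>"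
    unfolding is_covariation_def by (blast intro: ucp_limit_unique)
  with lim CS have "AE \<omega> in M. \<forall>t\<in>{0..T}.
      ((\<lambda>s. jump (\<lambda>r. Y r \<omega>) s * jump (\<lambda>r. Z r \<omega>) s) has_sum covariation M T Y Z t \<omega>) {0<..t}"
  proof eventually_elim
    case (elim \<omega>)
    show ?case
    proof
      fix t assume t: "t \<in> {0..T}"
      let ?w = "\<lambda>s. jump (\<lambda>r. Y r \<omega>) s * jump (\<lambda>r. Z r \<omega>) s"
      have "?w summable_on {0<..T}"
        using elim(1) summable_on_iff_abs_summable_on_real[of ?w] by simp
      then have "?w summable_on {0<..t}"
        by (rule summable_on_subset) (use t in auto)
      then have "(?w has_sum S t \<omega>) {0<..t}" unfolding S_def by (rule has_sum_infsum)
      then show "(?w has_sum covariation M T Y Z t \<omega>) {0<..t}" using elim(2,3) t by simp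
    qed
  qed
  with ex show ?thesis by blast
qed

end
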